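(* Let $\Xi$, $m$, $(U_x)$ on $\mathcal H$, $\widehat\Xi$, $\mathcal F_U$ and $\mathcal F_U^{-1}$ be as in the context, and assume the representation is integrable. Then $\mathcal F_U:\mathcal T^1(\mathcal H)\to C_0(\widehat\Xi)$ extends to a unitary operator $\mathcal F_U:\mathcal T^2(\mathcal H)\to L^2(\widehat\Xi)$, whose adjoint (inverse) $L^2(\widehat\Xi)\to\mathcal T^2(\mathcal H)$ is the extension of $\mathcal F_U^{-1}$ (i.e. it coincides with $\mathcal F_U^{-1}$ on $L^1(\widehat\Xi)\cap L^2(\widehat\Xi)$).
   Context: $\Xi$ is a locally compact abelian group; $m:\Xi\times\Xi\to S^1$ separately continuous with $m(x+y,z)m(x,y)=m(x,y+z)m(y,z)$, $m(x,0)=m(0,x)=1$, $m(x,y)=m(-x,-y)$, Heisenberg: $\sigma(x,y)=m(x,y)/m(y,x)$ and $x\mapsto\sigma(x,\cdot)$ a topological isomorphism $\Xi\to\widehat\Xi$. $(U_x)$ is the irreducible strongly continuous square integrable projective unitary representation on $\mathcal H$ with $U_xU_y=m(x,y)U_{x+y}$. Haar measure on $\Xi$ normalized so that $\int_\Xi\langle U_x\varphi_1,\psi_1\rangle\overline{\langle U_x\varphi_2,\psi_2\rangle}dx=\langle\varphi_1,\varphi_2\rangle\overline{\langle\psi_1,\psi_2\rangle}$. $\widehat\Xi$ denotes $\Xi$ (identified with its dual via $\sigma$) with Haar measure rescaled so that the symplectic Fourier transform $\mathcal F_\sigma f(\xi)=\int_\Xi\sigma(x,\xi)f(x)dx$ extends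 to a unitary $L^2(\Xi)\to L^2(\widehat\Xi)$. $\mathcal F_U(A)(\xi)=\operatorname{tr}(AU_\xi^* )$ for $A\in\mathcal T^1(\mathcal H)$; $\mathcal F_U^{-1}(f)=\int_{\widehat\Xi}f(\xi)U_\xi\,d\xi\in\mathcal L(\mathcal H)$ for $f\in L^1(\widehat\Xi)$ (strong integral). $\mathcal T^2(\mathcal H)$ is the Hilbert–Schmidt class. The representation is integrable if there is $0\ne\varphi\in\mathcal H$ with $x\mapsto\langle U_x\varphi,\varphi\rangle$ in $L^1(\Xi)$. *)

theory Defs
  imports "HOL-Analysis.Analysis"
begin

class hvec = ab_group_add +
  fixes hscale :: "complex \<Rightarrow> 'a \<Rightarrow> 'a"
  assumes hscale_add_right: "hscale a (x + y) = hscale a x + hscale a y"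
    and hscale_add_left: "hscale (a + b) x = hscale a x + hscale b x"
    and hscale_hscale: "hscale a (hscale b x) = hscale (a * b) x"
    and hscale_one: "hscale 1 x = x"

class hinner_space = hvec +
  fixes hinner :: "'a \<Rightarrow> 'a \<Rightarrow> complex"
  assumes hinner_add_left: "hinner (x + y) z = hinner x z + hinner y z"
    and hinner_hscale_left: "hinner (hscale a x) y = a * hinner x y"
    and hinner_cnj: "hinner y x = cnj (hinner x y)"
    and hinner_nonneg: "Im (hinner x x) = 0 \<and> Re (hinner x x) \<ge> 0"
    and hinner_eq_zero: "hinner x x = 0 \<longleftrightarrow> x = 0"

class chilbert = hinner_space +
  assumes hilbert_complete:
    "(\<forall>e>0. \<exists>N. \<forall>m\<ge>N. \<forall>n\<ge>N. sqrt (Re (hinner (X m - X n) (X m - X n))) < e)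
      \<Longrightarrow> \<exists>L. (\<lambda>n. sqrt (Re (hinner (X n - L) (X n - L)))) \<longlonglongrightarrow> 0"

definition hnorm :: "'h::hinner_space \<Rightarrow> real" where
  "hnorm x = sqrt (Re (hinner x x))"

definition clinear :: "('h::hvec \<Rightarrow> 'h) \<Rightarrow> bool" where
  "clinear A \<longleftrightarrow> (\<forall>x y. A (x + y) = A x + A y) \<and> (\<forall>c x. A (hscale c x) = hscale c (A x))"

definition cbounded :: "('h::hinner_space \<Rightarrow> 'h) \<Rightarrow> bool" where
  "cbounded A \<longleftrightarrow> (\<exists>C. \<forall>x. hnorm (A x) \<le> C * hnorm x)"

definition unitary_op :: "('h::hinner_space \<Rightarrow> 'h) \<Rightarrow> bool" where
  "unitary_op U \<longleftrightarrow> clinear U \<and> (\<forall>x y. hinner (U x) (U y) = hinner x y) \<and> surj U"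

definition hadj :: "('h::hinner_space \<Rightarrow> 'h) \<Rightarrow> 'h \<Rightarrow> 'h" where
  "hadj A = (\<lambda>y. THE z. \<forall>x. hinner (A x) y = hinner x z)"

definition orthonormal_basis :: "'h::hinner_space set \<Rightarrow> bool" where
  "orthonormal_basis B \<longleftrightarrow> (\<forall>e\<in>B. hinner e e = 1) \<and> (\<forall>e\<in>B. \<forall>f\<in>B. e \<noteq> f \<longrightarrow> hinner e f = 0)
     \<and> (\<forall>x. (\<forall>e\<in>B. hinner x e = 0) \<longrightarrow> x = 0)"

definition hilbert_schmidt :: "('h::hinner_space \<Rightarrow> 'h) \<Rightarrow> bool" where
  "hilbert_schmidt A \<longleftrightarrow> clinear A \<and> cbounded A \<and>
     (\<exists>B. orthonormal_basis B \<and> (\<lambda>e. (hnorm (A e))^2) summable_on B)"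

definition trace_class :: "('h::hinner_space \<Rightarrow> 'h) \<Rightarrow> bool" where
  "trace_class A \<longleftrightarrow> (\<exists>B C. hilbert_schmidt B \<and> hilbert_schmidt C \<and> A = B \<circ> C)"

definition op_trace :: "('h::hinner_space \<Rightarrow> 'h) \<Rightarrow> complex" where
  "op_trace A = infsum (\<lambda>e. hinner (A e) e) (SOME B. orthonormal_basis B)"

definition closed_subspace :: "'h::hinner_space set \<Rightarrow> bool" where
  "closed_subspace S \<longleftrightarrow> 0 \<in> S \<and> (\<forall>x\<in>S. \<forall>y\<in>S. x + y \<in> S) \<and> (\<forall>c. \<forall>x\<in>S. hscale c x \<in> S)
     \<and> (\<forall>X L. (\<forall>n. X n \<in> S) \<and> (\<lambda>n. hnorm (X n - L)) \<longlonglongrightarrow> 0 \<longrightarrow> L \<in> S)"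

definition lca_group :: "'a::{ab_group_add, t2_space} itself \<Rightarrow> bool" where
  "lca_group _ \<longleftrightarrow> continuous_on (UNIV :: ('a \<times> 'a) set) (\<lambda>(x, y). x + y)
     \<and> continuous_on (UNIV :: 'a set) uminus
     \<and> (\<forall>x::'a. \<exists>U K. open U \<and> compact K \<and> x \<in> U \<and> U \<subseteq> K)"

definition haar_measure :: "'a::{ab_group_add, t2_space} measure \<Rightarrow> bool" where
  "haar_measure \<mu> \<longleftrightarrow> sets \<mu> = sets borel
     \<and> (\<forall>x A. A \<in> sets borel \<longrightarrow> emeasure \<mu> ((\<lambda>y. x + y) ` A) = emeasure \<mu> A)
     \<and> (\<forall>K. compact K \<longrightarrow> emeasure \<mu> K < \<infinity>)
     \<and> (\<forall>U. open U \<and> U \<noteq> {} \<longrightarrow> emeasure \<mu> U > 0)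
     \<and> (\<forall>A \<in> sets borel. emeasure \<mu> A = (INF U\<in>{U. open U \<and> A \<subseteq> U}. emeasure \<mu> U))
     \<and> (\<forall>U. open U \<longrightarrow> emeasure \<mu> U = (SUP K\<in>{K. compact K \<and> K \<subseteq> U}. emeasure \<mu> K))"

definition multiplier :: "('a::{ab_group_add, t2_space} \<Rightarrow> 'a \<Rightarrow> complex) \<Rightarrow> bool" where
  "multiplier m \<longleftrightarrow> (\<forall>x y. cmod (m x y) = 1)
     \<and> (\<forall>x. continuous_on UNIV (m x) \<and> continuous_on UNIV (\<lambda>y. m y x))
     \<and> (\<forall>x y z. m (x + y) z * m x y = m x (y + z) * m y z)
     \<and> (\<forall>x. m x 0 = 1 \<and> m 0 x = 1)
     \<and> (\<forall>x y. m x y = m (- x) (- y))"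

definition sympl :: "('a \<Rightarrow> 'a \<Rightarrow> complex) \<Rightarrow> 'a \<Rightarrow> 'a \<Rightarrow> complex" where
  "sympl m x y = m x y / m y x"

definition is_character :: "('a::{ab_group_add, topological_space} \<Rightarrow> complex) \<Rightarrow> bool" where
  "is_character chi \<longleftrightarrow> continuous_on UNIV chi \<and> (\<forall>x. cmod (chi x) = 1) \<and> (\<forall>x y. chi (x + y) = chi x * chi y)"

text \<open>x \<mapsto> sympl m x is a bijection onto the continuous characters and a homeomorphism
  for the compact-open topology on the dual group (neighbourhood bases written out).\<close>
definition heisenberg :: "('a::{ab_group_add, t2_space} \<Rightarrow> 'a \<Rightarrow> complex) \<Rightarrow> bool" where
  "heisenberg m \<longleftrightarrow> (\<forall>x. is_character (sympl m x)) \<and> inj (sympl m)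
     \<and> (\<forall>chi. is_character chi \<longrightarrow> (\<exists>x. chi = sympl m x))
     \<and> (\<forall>x0 K e. compact K \<and> e > 0 \<longrightarrow>
          (\<exists>V. open V \<and> x0 \<in> V \<and> (\<forall>x\<in>V. \<forall>y\<in>K. cmod (sympl m x y - sympl m x0 y) < e)))
     \<and> (\<forall>x0 V. open V \<and> x0 \<in> V \<longrightarrow>
          (\<exists>K e. compact K \<and> e > 0 \<and> (\<forall>x. (\<forall>y\<in>K. cmod (sympl m x y - sympl m x0 y) < e) \<longrightarrow> x \<in> V)))"

definition proj_rep_sq :: "'a::{ab_group_add, t2_space} measure \<Rightarrow> ('a \<Rightarrow> 'a \<Rightarrow> complex)
    \<Rightarrow> ('a \<Rightarrow> 'h::chilbert \<Rightarrow> 'h) \<Rightarrow> bool" where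
  "proj_rep_sq \<mu> m U \<longleftrightarrow> (\<forall>x. unitary_op (U x))
     \<and> (\<forall>x y. U x \<circ> U y = (\<lambda>\<phi>. hscale (m x y) (U (x + y) \<phi>)))
     \<and> (\<forall>\<phi> x0 e. e > 0 \<longrightarrow> (\<exists>V. open V \<and> x0 \<in> V \<and> (\<forall>x\<in>V. hnorm (U x \<phi> - U x0 \<phi>) < e)))
     \<and> (\<forall>S. closed_subspace S \<and> (\<forall>x. U x ` S \<subseteq> S) \<longrightarrow> S = {0} \<or> S = UNIV)
     \<and> (\<exists>\<phi>. \<phi> \<noteq> 0 \<and> integrable \<mu> (\<lambda>x. (cmod (hinner (U x \<phi>) \<phi>))^2))"

definition haar_normalized :: "'a::{ab_group_add, t2_space} measure \<Rightarrow> ('a \<Rightarrow> 'h::chilbert \<Rightarrow> 'h) \<Rightarrow> bool" where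
  "haar_normalized \<mu> U \<longleftrightarrow> (\<forall>\<phi>1 \<psi>1 \<phi>2 \<psi>2.
      integrable \<mu> (\<lambda>x. hinner (U x \<phi>1) \<psi>1 * cnj (hinner (U x \<phi>2) \<psi>2))
    \<and> (LINT x|\<mu>. hinner (U x \<phi>1) \<psi>1 * cnj (hinner (U x \<phi>2) \<psi>2)) = hinner \<phi>1 \<phi>2 * cnj (hinner \<psi>1 \<psi>2))"

definition integrable_rep :: "'a::{ab_group_add, t2_space} measure \<Rightarrow> ('a \<Rightarrow> 'h::chilbert \<Rightarrow> 'h) \<Rightarrow> bool" where
  "integrable_rep \<mu> U \<longleftrightarrow> (\<exists>\<phi>. \<phi> \<noteq> 0 \<and> integrable \<mu> (\<lambda>x. hinner (U x \<phi>) \<phi>))"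

definition sfourier :: "'a::{ab_group_add, t2_space} measure \<Rightarrow> ('a \<Rightarrow> 'a \<Rightarrow> complex)
    \<Rightarrow> ('a \<Rightarrow> complex) \<Rightarrow> 'a \<Rightarrow> complex" where
  "sfourier \<mu> m f \<xi> = (LINT x|\<mu>. sympl m x \<xi> * f x)"

text \<open>The measure on the dual: a positive rescaling of the Haar measure making the
  symplectic Fourier transform isometric (hence unitary) on L1 \<inter> L2.\<close>
definition dual_haar :: "'a::{ab_group_add, t2_space} measure \<Rightarrow> ('a \<Rightarrow> 'a \<Rightarrow> complex) \<Rightarrow> 'a measure \<Rightarrow> bool" where
  "dual_haar \<mu> m \<nu> \<longleftrightarrow> (\<exists>c::real. c > 0 \<and> \<nu> = scale_measure (ennreal c) \<mu>)
     \<and> (\<forall>f. integrable \<mu> f \<and> integrable \<mu> (\<lambda>x. (cmod (f x))^2) \<longrightarrow>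
          integrable \<nu> (\<lambda>\<xi>. (cmod (sfourier \<mu> m f \<xi>))^2)
          \<and> (LINT \<xi>|\<nu>. (cmod (sfourier \<mu> m f \<xi>))^2) = (LINT x|\<mu>. (cmod (f x))^2))"

definition fourier_U :: "('a \<Rightarrow> 'h::chilbert \<Rightarrow> 'h) \<Rightarrow> ('h \<Rightarrow> 'h) \<Rightarrow> 'a \<Rightarrow> complex" where
  "fourier_U U A \<xi> = op_trace (A \<circ> hadj (U \<xi>))"

text \<open>Inverse Fourier transform as a (weakly = strongly) integrated operator.\<close>
definition fourier_U_inv :: "'a::{ab_group_add, t2_space} measure \<Rightarrow> ('a \<Rightarrow> 'h::chilbert \<Rightarrow> 'h)
    \<Rightarrow> ('a \<Rightarrow> complex) \<Rightarrow> 'h \<Rightarrow> 'h" where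
  "fourier_U_inv \<nu> U f = (\<lambda>\<phi>. THE z. \<forall>\<psi>. hinner z \<psi> = (LINT \<xi>|\<nu>. f \<xi> * hinner (U \<xi> \<phi>) \<psi>))"

end

theory Submission
  imports Defs "HOL-Library.Function_Algebras"
begin

text \<open>
  The functions \<open>x \<mapsto> cnj \<langle>U\<^sub>x e, f\<rangle>\<close>, for \<open>e\<close> and \<open>f\<close> in an orthonormal basis of \<open>H\<close>, are
  orthonormal by the normalization of the Haar measure. They are also total: if \<open>g\<close> is orthogonal to
  all coefficients, then, as conjugating \<open>U\<^sub>x\<close> by \<open>U\<^sub>\<xi>\<close> multiplies it by \<open>\<sigma>(x, \<xi>)\<close>, the symplectic
  Fourier transform of \<open>g \<langle>U p, q\<rangle>\<close> vanishes, hence so does \<open>g \<langle>U p, q\<rangle>\<close> by Plancherel, and finally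
  \<open>g = 0\<close>, because every point has a neighbourhood on which some coefficient has no zero.
  Riesz-Fischer and Parseval then identify \<open>g \<in> L\<^sup>2\<close> with the Hilbert-Schmidt operator \<open>A\<close> determined by
  \<open>\<langle>A p, q\<rangle> = \<integral> g \<langle>U p, q\<rangle>\<close>. For \<open>A = P Q\<close> of trace class the trace of \<open>A U\<^sub>\<xi>\<^sup>*\<close> equals
  \<open>\<Sum>\<^sub>f cnj \<langle>U\<^sub>\<xi> Q\<^sup>* f, P f\<rangle>\<close>; this series converges uniformly in \<open>\<xi>\<close>, and its partial sums
  converge in \<open>L\<^sup>2\<close> to the function representing \<open>A\<close>.
\<close>

section \<open>Complete semi-inner product spaces\<close>

text \<open>A carrier set and a possibly degenerate inner product, so that the square integrable functions
  form an instance without passing to classes modulo null sets.\<close>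
locale semi_hilbert =
  fixes S :: "'v::ab_group_add set"
    and scl :: "complex \<Rightarrow> 'v \<Rightarrow> 'v"
    and ip :: "'v \<Rightarrow> 'v \<Rightarrow> complex"
  assumes zero_mem: "0 \<in> S"
    and add_mem: "\<And>x y. x \<in> S \<Longrightarrow> y \<in> S \<Longrightarrow> x + y \<in> S"
    and scl_mem: "\<And>c x. x \<in> S \<Longrightarrow> scl c x \<in> S"
    and scl_minus_one: "\<And>x. scl (- 1) x = - x"
    and ip_add_left: "\<And>x y z. x \<in> S \<Longrightarrow> y \<in> S \<Longrightarrow> z \<in> S \<Longrightarrow> ip (x + y) z = ip x z + ip y z"
    and ip_scl_left: "\<And>c x y. x \<in> S \<Longrightarrow> y \<in> S \<Longrightarrow> ip (scl c x) y = c * ip x y"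
    and ip_cnj: "\<And>x y. x \<in> S \<Longrightarrow> y \<in> S \<Longrightarrow> ip y x = cnj (ip x y)"
    and ip_nonneg: "\<And>x. x \<in> S \<Longrightarrow> Re (ip x x) \<ge> 0"
    and complete: "\<And>X. (\<And>n. X n \<in> S) \<Longrightarrow>
      (\<forall>e>0. \<exists>N. \<forall>m\<ge>N. \<forall>n\<ge>N. sqrt (Re (ip (X m - X n) (X m - X n))) < e) \<Longrightarrow>
      \<exists>L\<in>S. (\<lambda>n. sqrt (Re (ip (X n - L) (X n - L)))) \<longlonglongrightarrow> 0"
begin

definition nrm :: "'v \<Rightarrow> real" where
  "nrm x = sqrt (Re (ip x x))"

lemma uminus_mem: "x \<in> S \<Longrightarrow> - x \<in> S"
  using scl_mem[of x "- 1"] by (simp add: scl_minus_one)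

lemma diff_mem: "x \<in> S \<Longrightarrow> y \<in> S \<Longrightarrow> x - y \<in> S"
  using add_mem[of x "- y"] uminus_mem[of y] by simp

lemma sum_mem: "(\<And>i. i \<in> F \<Longrightarrow> f i \<in> S) \<Longrightarrow> sum f F \<in> S"
  by (induction F rule: infinite_finite_induct) (auto simp: zero_mem add_mem)

lemma additive_sum:
  fixes \<phi> :: "'v \<Rightarrow> complex"
  assumes add: "\<And>x y. x \<in> S \<Longrightarrow> y \<in> S \<Longrightarrow> \<phi> (x + y) = \<phi> x + \<phi> y"
    and f: "\<And>i. i \<in> F \<Longrightarrow> f i \<in> S"
  shows "\<phi> (sum f F) = (\<Sum>i\<in>F. \<phi> (f i))"
proof -
  have "\<phi> 0 = 0" using add[of 0 0] zero_mem by simp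
  then show ?thesis using f
    by (induction F rule: infinite_finite_induct) (auto simp: add sum_mem)
qed

lemma ip_minus_left: "x \<in> S \<Longrightarrow> y \<in> S \<Longrightarrow> ip (- x) y = - ip x y"
  using ip_scl_left[of x y "- 1"] by (simp add: scl_minus_one)

lemma ip_diff_left: "x \<in> S \<Longrightarrow> y \<in> S \<Longrightarrow> z \<in> S \<Longrightarrow> ip (x - y) z = ip x z - ip y z"
  using ip_add_left[of x "- y" z] uminus_mem[of y] ip_minus_left[of y z] by simp

lemma ip_zero_left: "x \<in> S \<Longrightarrow> ip 0 x = 0"
  using ip_diff_left[of x x x] by simp

lemma ip_add_right: "x \<in> S \<Longrightarrow> y \<in> S \<Longrightarrow> z \<in> S \<Longrightarrow> ip z (x + y) = ip z x + ip z y"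
  using ip_add_left[of x y z] ip_cnj[of "x + y" z] ip_cnj[of x z] ip_cnj[of y z] add_mem by simp

lemma ip_diff_right: "x \<in> S \<Longrightarrow> y \<in> S \<Longrightarrow> z \<in> S \<Longrightarrow> ip z (x - y) = ip z x - ip z y"
  using ip_diff_left[of x y z] ip_cnj[of "x - y" z] ip_cnj[of x z] ip_cnj[of y z] diff_mem by simp

lemma ip_scl_right: "x \<in> S \<Longrightarrow> y \<in> S \<Longrightarrow> ip y (scl c x) = cnj c * ip y x"
  using ip_scl_left[of x y c] ip_cnj[of "scl c x" y] ip_cnj[of x y] scl_mem by simp

lemma ip_sum_left:
  assumes "\<And>i. i \<in> F \<Longrightarrow> f i \<in> S" "z \<in> S"
  shows "ip (\<Sum>i\<in>F. f i) z = (\<Sum>i\<in>F. ip (f i) z)"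
  using assms
  by (induction F rule: infinite_finite_induct)
     (auto simp: ip_zero_left ip_add_left sum_mem)

lemma nrm_nonneg [simp]: "x \<in> S \<Longrightarrow> nrm x \<ge> 0"
  by (simp add: nrm_def ip_nonneg)

lemma nrm_power2: "x \<in> S \<Longrightarrow> (nrm x)\<^sup>2 = Re (ip x x)"
  by (simp add: nrm_def ip_nonneg)

lemma ip_self: "x \<in> S \<Longrightarrow> ip x x = of_real ((nrm x)\<^sup>2)"
  using ip_cnj[of x x] by (simp add: nrm_power2 complex_eq_iff)

text \<open>The squared seminorm of \<open>x - t c y\<close>, with \<open>c = ip x y\<close> and
  \<open>t\<close> real, is a nonnegative quadratic polynomial in \<open>t\<close>. As the form may
  be degenerate, \<open>nrm y = 0\<close> is a case of its own.\<close>

lemma Cauchy_Schwarz: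
  assumes "x \<in> S" "y \<in> S"
  shows "cmod (ip x y) \<le> nrm x * nrm y"
proof -
  define a b c where "a = (nrm x)\<^sup>2" and "b = (nrm y)\<^sup>2" and "c = ip x y"
  have key: "0 \<le> a - 2 * t * (cmod c)\<^sup>2 + t\<^sup>2 * (cmod c)\<^sup>2 * b" for t :: real
  proof -
    define z where "z = scl (of_real t * c) y"
    have z: "z \<in> S" using assms by (simp add: z_def scl_mem)
    have xz: "ip x z = of_real (t * (cmod c)\<^sup>2)"
      using assms by (simp add: z_def ip_scl_right c_def complex_norm_square mult_ac del: of_real_power)
    have zz: "ip z z = of_real (t\<^sup>2 * (cmod c)\<^sup>2 * b)"
    proof -
      have "ip z z = of_real t * c * (cnj (of_real t * c) * ip y y)"
        unfolding z_def using assms by (simp add: ip_scl_right ip_scl_left scl_mem)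
      also have "\<dots> = of_real (t\<^sup>2) * (c * cnj c) * of_real b"
        using assms by (simp add: ip_self b_def power2_eq_square)
      finally show ?thesis by (simp flip: complex_norm_square)
    qed
    have "ip (x - z) (x - z) = ip x x - ip x z - (cnj (ip x z) - ip z z)"
      using assms z by (simp add: ip_diff_left ip_diff_right diff_mem ip_cnj[of x z])
    then have "Re (ip (x - z) (x - z)) = a - 2 * t * (cmod c)\<^sup>2 + t\<^sup>2 * (cmod c)\<^sup>2 * b"
      using assms by (simp only: xz zz ip_self a_def) simp
    then show ?thesis using ip_nonneg[of "x - z"] diff_mem assms z by simp
  qed
  have "(cmod c)\<^sup>2 \<le> a * b"
  proof (cases "b = 0")
    case True
    have "(cmod c)\<^sup>2 = 0"
    proof (rule ccontr)
      assume n: "(cmod c)\<^sup>2 \<noteq> 0"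
      \<comment> \<open>With \<open>b = 0\<close> the polynomial is linear in \<open>t\<close>; this
        \<open>t\<close> makes its value \<open>- a - 2\<close>, which is negative.\<close>
      have "0 \<le> a - 2 * ((a + 1) / (cmod c)\<^sup>2) * (cmod c)\<^sup>2"
        using key[of "(a + 1) / (cmod c)\<^sup>2"] True by simp
      then have "0 \<le> a - 2 * (a + 1)" using n by simp
      moreover have "a \<ge> 0" by (simp add: a_def)
      ultimately show False by simp
    qed
    then show ?thesis using True by simp
  next
    case False
    then have b: "b > 0" by (simp add: b_def)
    \<comment> \<open>The quadratic attains its minimum at \<open>t = 1 / b\<close>.\<close>
    have "0 \<le> a - (cmod c)\<^sup>2 / b"
      using key[of "1 / b"] b by (simp add: power2_eq_square field_simps)
    then show ?thesis using b by (simp add: field_simps)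
  qed
  then have "(cmod c)\<^sup>2 \<le> (nrm x * nrm y)\<^sup>2" by (simp add: a_def b_def power_mult_distrib)
  then show ?thesis unfolding c_def
    by (rule power2_le_imp_le) (simp add: assms)
qed

lemma nrm_diff_power2:
  assumes "x \<in> S" "y \<in> S"
  shows "(nrm (x - y))\<^sup>2 = (nrm x)\<^sup>2 - 2 * Re (ip x y) + (nrm y)\<^sup>2"
proof -
  have "ip (x - y) (x - y) = ip x x - ip x y - (cnj (ip x y) - ip y y)"
    using assms by (simp add: ip_diff_left ip_diff_right diff_mem ip_cnj[of x y])
  then show ?thesis using assms by (simp add: nrm_power2 diff_mem)
qed

text \<open>In the degenerate setting this replaces the conclusion that a vector of norm 0 is
  0.\<close>

lemma nrm_null_ip:
  assumes "x \<in> S" "y \<in> S" "nrm x = 0"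
  shows "ip x y = 0"
  using Cauchy_Schwarz[OF assms(1,2)] assms(3) by simp

end

text \<open>The Cauchy criterion for unordered sums: the sums over \<open>F\<close> and over
  \<open>F \<union> G\<close> both lie within \<epsilon>/2 of the total, and their difference is the
  sum over \<open>G\<close>.\<close>

lemma summable_on_tail_less:
  fixes f :: "'i \<Rightarrow> real"
  assumes "f summable_on I" "\<And>i. i \<in> I \<Longrightarrow> f i \<ge> 0" "\<epsilon> > 0"
  obtains F where "finite F" "F \<subseteq> I" "\<And>G. finite G \<Longrightarrow> G \<subseteq> I \<Longrightarrow> G \<inter> F = {} \<Longrightarrow> sum f G < \<epsilon>"
proof -
  obtain s where s: "(f has_sum s) I" using assms(1) by (auto simp: summable_on_def)
  then have "\<forall>\<^sub>F F in finite_subsets_at_top I. dist (sum f F) s < \<epsilon> / 2"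
    unfolding has_sum_def by (rule tendstoD) (use assms(3) in simp)
  then obtain F where F: "finite F" "F \<subseteq> I"
    "\<And>G. finite G \<Longrightarrow> F \<subseteq> G \<Longrightarrow> G \<subseteq> I \<Longrightarrow> dist (sum f G) s < \<epsilon> / 2"
    unfolding eventually_finite_subsets_at_top by metis
  show thesis
  proof (rule that[OF F(1,2)])
    fix G assume G: "finite G" "G \<subseteq> I" "G \<inter> F = {}"
    have "sum f (F \<union> G) = sum f F + sum f G"
      using G(3) by (intro sum.union_disjoint[OF F(1) G(1)]) blast
    moreover have "dist (sum f (F \<union> G)) s < \<epsilon> / 2" "dist (sum f F) s < \<epsilon> / 2"
      using F(1,2) G by (auto intro!: F(3) simp del: less_divide_eq_numeral1)
    ultimately show "sum f G < \<epsilon>" unfolding dist_real_def by linarith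
  qed
qed

section \<open>Orthonormal families: Bessel's inequality and the Riesz-Fischer theorem\<close>

locale orthonormal_family = semi_hilbert S scl ip
  for S :: "'v::ab_group_add set" and scl ip +
  fixes I :: "'i set" and E :: "'i \<Rightarrow> 'v"
  assumes E_mem: "\<And>i. i \<in> I \<Longrightarrow> E i \<in> S"
    and E_orthonormal: "\<And>i j. i \<in> I \<Longrightarrow> j \<in> I \<Longrightarrow> ip (E i) (E j) = (if i = j then 1 else 0)"
begin

definition lincomb :: "('i \<Rightarrow> complex) \<Rightarrow> 'i set \<Rightarrow> 'v" where
  "lincomb c F = (\<Sum>i\<in>F. scl (c i) (E i))"

lemma lincomb_mem: "F \<subseteq> I \<Longrightarrow> lincomb c F \<in> S"
  unfolding lincomb_def by (intro sum_mem scl_mem E_mem) auto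

lemma ip_lincomb_left: "F \<subseteq> I \<Longrightarrow> x \<in> S \<Longrightarrow> ip (lincomb c F) x = (\<Sum>i\<in>F. c i * ip (E i) x)"
  unfolding lincomb_def
  by (subst ip_sum_left) (auto intro!: scl_mem E_mem sum.cong ip_scl_left)

lemma ip_lincomb_E:
  assumes "finite F" "F \<subseteq> I" "i \<in> I"
  shows "ip (lincomb c F) (E i) = (if i \<in> F then c i else 0)"
proof -
  have "ip (lincomb c F) (E i) = (\<Sum>j\<in>F. if j = i then c j else 0)"
    unfolding ip_lincomb_left[OF assms(2) E_mem[OF assms(3)]]
    using assms by (intro sum.cong) (auto simp: E_orthonormal subset_iff)
  then show ?thesis using assms by simp
qed

lemma ip_lincomb_lincomb:
  assumes "finite F" "F \<subseteq> I" "finite G" "G \<subseteq> I"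
  shows "ip (lincomb c F) (lincomb c G) = of_real (\<Sum>i\<in>F \<inter> G. (cmod (c i))\<^sup>2)"
proof -
  have "ip (lincomb c F) (lincomb c G) = (\<Sum>i\<in>F. c i * cnj (ip (lincomb c G) (E i)))"
    using assms by (subst ip_lincomb_left)
      (auto intro!: sum.cong lincomb_mem simp: ip_cnj[OF lincomb_mem E_mem] subset_iff)
  also have "\<dots> = (\<Sum>i\<in>F. if i \<in> G then c i * cnj (c i) else 0)"
    using assms by (intro sum.cong) (auto simp: ip_lincomb_E subset_iff)
  also have "\<dots> = (\<Sum>i\<in>F \<inter> G. of_real ((cmod (c i))\<^sup>2))"
    using assms by (simp add: sum.inter_restrict complex_norm_square del: of_real_power cong: if_cong)
  finally show ?thesis by simp
qed

text \<open>The inner product of two partial sums only sees the common indices, so expanding the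
  square leaves the symmetric difference.\<close>

lemma nrm_lincomb_diff:
  assumes "finite F" "F \<subseteq> I" "finite G" "G \<subseteq> I"
  shows "(nrm (lincomb c F - lincomb c G))\<^sup>2 =
    (\<Sum>i\<in>F - G. (cmod (c i))\<^sup>2) + (\<Sum>i\<in>G - F. (cmod (c i))\<^sup>2)"
proof -
  have F: "(\<Sum>i\<in>F. (cmod (c i))\<^sup>2) = (\<Sum>i\<in>F \<inter> G. (cmod (c i))\<^sup>2) + (\<Sum>i\<in>F - G. (cmod (c i))\<^sup>2)"
    using assms(1) by (rule sum.Int_Diff)
  have G: "(\<Sum>i\<in>G. (cmod (c i))\<^sup>2) = (\<Sum>i\<in>F \<inter> G. (cmod (c i))\<^sup>2) + (\<Sum>i\<in>G - F. (cmod (c i))\<^sup>2)"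
    using sum.Int_Diff[OF assms(3), of _ F] by (simp add: Int_commute)
  show ?thesis
    using assms F G
    by (simp add: nrm_diff_power2 lincomb_mem nrm_power2 ip_lincomb_lincomb)
qed

text \<open>Pythagoras: the partial expansion \<open>y\<close> of \<open>x\<close> satisfies
  \<open>ip y x = ip y y\<close>, so the residual is orthogonal to it.\<close>

lemma nrm_diff_lincomb:
  assumes "finite F" "F \<subseteq> I" "x \<in> S"
  shows "(nrm (x - lincomb (\<lambda>i. ip x (E i)) F))\<^sup>2 = (nrm x)\<^sup>2 - (\<Sum>i\<in>F. (cmod (ip x (E i)))\<^sup>2)"
proof -
  let ?y = "lincomb (\<lambda>i. ip x (E i)) F"
  have y: "?y \<in> S" using assms by (simp add: lincomb_mem)
  have "ip ?y x = (\<Sum>i\<in>F. ip x (E i) * cnj (ip x (E i)))"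
    using assms by (subst ip_lincomb_left)
      (auto intro!: sum.cong simp: ip_cnj[OF _ E_mem, of x] subset_iff)
  then have "ip ?y x = of_real (\<Sum>i\<in>F. (cmod (ip x (E i)))\<^sup>2)"
    by (simp add: complex_norm_square del: of_real_power)
  moreover have "(nrm ?y)\<^sup>2 = (\<Sum>i\<in>F. (cmod (ip x (E i)))\<^sup>2)"
    using assms y by (simp add: nrm_power2 ip_lincomb_lincomb)
  ultimately show ?thesis using assms y by (simp add: nrm_diff_power2 ip_cnj[of ?y x])
qed

lemma Bessel_finite:
  assumes "finite F" "F \<subseteq> I" "x \<in> S"
  shows "(\<Sum>i\<in>F. (cmod (ip x (E i)))\<^sup>2) \<le> (nrm x)\<^sup>2"
  using nrm_diff_lincomb[OF assms] zero_le_power2[of "nrm (x - lincomb (\<lambda>i. ip x (E i)) F)"] by linarith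

lemma Bessel_summable:
  assumes "x \<in> S"
  shows "(\<lambda>i. (cmod (ip x (E i)))\<^sup>2) summable_on I"
  by (rule nonneg_bdd_above_summable_on)
     (auto intro!: bdd_aboveI2 Bessel_finite assms)

text \<open>The index set may be uncountable while completeness speaks of sequences. Hence finite
  sets \<open>F n\<close> with tails below 1/(n+1) are fixed, and the partial sums over them form a
  Cauchy sequence whose limit is the vector sought.\<close>

lemma Riesz_Fischer:
  assumes "(\<lambda>i. (cmod (c i))\<^sup>2) summable_on I"
  obtains x where "x \<in> S" "\<And>i. i \<in> I \<Longrightarrow> ip x (E i) = c i"
    "((\<lambda>i. (cmod (c i))\<^sup>2) has_sum (nrm x)\<^sup>2) I"
proof -
  let ?a = "\<lambda>i. (cmod (c i))\<^sup>2"
  have "\<exists>F. finite F \<and> F \<subseteq> I \<and> (\<forall>G. finite G \<longrightarrow> G \<subseteq> I \<longrightarrow> G \<inter> F = {} \<longrightarrow> sum ?a G < inverse (Suc n))" for n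
    by (rule summable_on_tail_less[OF assms, of "inverse (Suc n)"]) auto
  then obtain F where F: "\<And>n. finite (F n)" "\<And>n. F n \<subseteq> I"
    "\<And>n G. finite G \<Longrightarrow> G \<subseteq> I \<Longrightarrow> G \<inter> F n = {} \<Longrightarrow> sum ?a G < inverse (Suc n)"
    by metis
  define X where "X n = lincomb c (F n)" for n
  have X: "X n \<in> S" for n unfolding X_def using F by (simp add: lincomb_mem)
  \<comment> \<open>The indices in \<open>F m\<close> but not in \<open>F n\<close> form a tail for
    \<open>F n\<close>, and conversely; the sets need not be nested.\<close>
  have XX: "(nrm (X m - X n))\<^sup>2 < inverse (Suc m) + inverse (Suc n)" for m n
  proof -
    have "sum ?a (F m - F n) < inverse (Suc n)" "sum ?a (F n - F m) < inverse (Suc m)"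
      using F(1)[of m] F(1)[of n] F(2)[of m] F(2)[of n] by (auto intro!: F(3) simp del: of_nat_Suc)
    then show ?thesis unfolding X_def using F(1,2) by (simp add: nrm_lincomb_diff del: of_nat_Suc)
  qed
  have "\<exists>L\<in>S. (\<lambda>n. sqrt (Re (ip (X n - L) (X n - L)))) \<longlonglongrightarrow> 0"
  proof (rule complete[OF X], intro allI impI)
    fix e :: real assume e: "e > 0"
    then obtain N where N: "inverse (real (Suc N)) < e\<^sup>2 / 2"
      using reals_Archimedean[of "e\<^sup>2 / 2"] by auto
    show "\<exists>N. \<forall>m\<ge>N. \<forall>n\<ge>N. sqrt (Re (ip (X m - X n) (X m - X n))) < e"
    proof (intro exI allI impI)
      fix m n assume "N \<le> m" "N \<le> n"
      then have "inverse (real (Suc m)) \<le> inverse (real (Suc N))"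
        "inverse (real (Suc n)) \<le> inverse (real (Suc N))"
        by (auto intro!: le_imp_inverse_le)
      then have "(nrm (X m - X n))\<^sup>2 < e\<^sup>2" using XX[of m n] N by linarith
      then have "nrm (X m - X n) < e" by (rule power2_less_imp_less) (use e in simp)
      then show "sqrt (Re (ip (X m - X n) (X m - X n))) < e" by (simp add: nrm_def)
    qed
  qed
  then obtain L where L: "L \<in> S" "(\<lambda>n. nrm (X n - L)) \<longlonglongrightarrow> 0" by (auto simp: nrm_def)
  have inv0: "(\<lambda>n. sqrt (inverse (real (Suc n)))) \<longlonglongrightarrow> 0"
    using tendsto_real_sqrt[OF LIMSEQ_inverse_real_of_nat] by simp
  have coef: "ip L (E i) = c i" if i: "i \<in> I" for i
  proof -
    have ei: "nrm (E i) = 1" using i by (simp add: nrm_def E_orthonormal)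
    have "cmod (c i - ip L (E i)) \<le> nrm (X n - L) + sqrt (inverse (real (Suc n)))" for n
    proof -
      have "cmod (ip (X n) (E i) - ip L (E i)) \<le> nrm (X n - L)"
        using Cauchy_Schwarz[of "X n - L" "E i"] X L i ei by (simp add: ip_diff_left E_mem diff_mem)
      moreover have "cmod (c i - ip (X n) (E i)) \<le> sqrt (inverse (real (Suc n)))"
      proof (cases "i \<in> F n")
        case True
        then show ?thesis using F i by (simp add: X_def ip_lincomb_E del: of_nat_Suc)
      next
        case False
        \<comment> \<open>An index outside \<open>F n\<close>, possibly one that lies in no
          \<open>F n\<close> at all, forms a tail by itself, so its coefficient is small.\<close>
        then have "sum ?a {i} < inverse (real (Suc n))" using i by (intro F) auto
        then have "cmod (c i) \<le> sqrt (inverse (real (Suc n)))"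
          by (intro real_le_rsqrt) (simp del: of_nat_Suc)
        then show ?thesis using F i False by (simp add: X_def ip_lincomb_E del: of_nat_Suc)
      qed
      ultimately show ?thesis
        using norm_triangle_ineq[of "c i - ip (X n) (E i)" "ip (X n) (E i) - ip L (E i)"] by simp
    qed
    moreover have "(\<lambda>n. nrm (X n - L) + sqrt (inverse (real (Suc n)))) \<longlonglongrightarrow> 0 + 0"
      by (intro tendsto_add L inv0)
    ultimately have "cmod (c i - ip L (E i)) \<le> 0 + 0"
      by (intro LIMSEQ_le_const) auto
    then show ?thesis by simp
  qed
  have upper: "sum ?a G \<le> (nrm L)\<^sup>2" if "finite G" "G \<subseteq> I" for G
  proof -
    have "sum ?a G = (\<Sum>i\<in>G. (cmod (ip L (E i)))\<^sup>2)"
      using that coef by (intro sum.cong) auto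
    then show ?thesis using Bessel_finite[OF that L(1)] by simp
  qed
  have "((\<lambda>n. (nrm (X n - L))\<^sup>2) \<longlonglongrightarrow> 0\<^sup>2)" by (intro tendsto_power L)
  \<comment> \<open>\<open>X n\<close> is the partial expansion of \<open>L\<close>, so the residual
    formula applies. As the residual tends to 0, this gives the lower bound for the infinite sum;
    Bessel gave the upper one.\<close>
  moreover have "(nrm (X n - L))\<^sup>2 = (nrm L)\<^sup>2 - sum ?a (F n)" for n
  proof -
    have "lincomb (\<lambda>i. ip L (E i)) (F n) = X n"
      unfolding X_def lincomb_def using F(2)[of n] coef by (intro sum.cong) (auto simp: subset_iff)
    moreover have "(\<Sum>i\<in>F n. (cmod (ip L (E i)))\<^sup>2) = sum ?a (F n)"
      using F(2)[of n] coef by (intro sum.cong) (auto simp: subset_iff)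
    moreover have "(nrm (X n - L))\<^sup>2 = (nrm (L - X n))\<^sup>2"
      using X L ip_cnj[of L "X n"] by (simp add: nrm_diff_power2)
    ultimately show ?thesis using nrm_diff_lincomb[of "F n" L] F L by simp
  qed
  ultimately have lim: "(\<lambda>n. (nrm L)\<^sup>2 - sum ?a (F n)) \<longlonglongrightarrow> 0" by simp
  have "(?a has_sum (nrm L)\<^sup>2) I"
  proof -
    have "infsum ?a I \<le> (nrm L)\<^sup>2"
      using assms upper by (intro infsum_le_finite_sums) auto
    moreover have "(nrm L)\<^sup>2 \<le> infsum ?a I"
    proof -
      have "(nrm L)\<^sup>2 - infsum ?a I \<le> (nrm L)\<^sup>2 - sum ?a (F n)" for n
        using finite_sum_le_infsum[OF assms F(1)[of n] F(2)[of n]] by simp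
      then have "(nrm L)\<^sup>2 - infsum ?a I \<le> 0"
        by (intro LIMSEQ_le_const[OF lim]) auto
      then show ?thesis by simp
    qed
    ultimately show ?thesis using assms has_sum_infsum by force
  qed
  then show thesis using that L coef by blast
qed

end

section \<open>Complete orthonormal families: Parseval, expansion of functionals, Riesz
  representation\<close>

locale complete_orthonormal_family = orthonormal_family S scl ip I E
  for S :: "'v::ab_group_add set" and scl ip and I :: "'i set" and E +
  assumes total: "\<And>x. x \<in> S \<Longrightarrow> (\<And>i. i \<in> I \<Longrightarrow> ip x (E i) = 0) \<Longrightarrow> nrm x = 0"
begin

text \<open>Riesz-Fischer produces \<open>y\<close> with the coefficients of \<open>x\<close> and
  with the right norm. By totality \<open>x - y\<close> has seminorm 0, so \<open>x\<close> and
  \<open>y\<close> have equal norms although they need not be equal.\<close>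

lemma Parseval:
  assumes "x \<in> S"
  shows "((\<lambda>i. (cmod (ip x (E i)))\<^sup>2) has_sum (nrm x)\<^sup>2) I"
proof -
  obtain y where y: "y \<in> S" "\<And>i. i \<in> I \<Longrightarrow> ip y (E i) = ip x (E i)"
    "((\<lambda>i. (cmod (ip x (E i)))\<^sup>2) has_sum (nrm y)\<^sup>2) I"
    using Riesz_Fischer[OF Bessel_summable[OF assms]] by blast
  have d: "x - y \<in> S" using assms y diff_mem by blast
  have "nrm (x - y) = 0"
    using assms y by (intro total) (auto simp: diff_mem ip_diff_left E_mem)
  then have "ip (x - y) x = 0" "ip (x - y) y = 0"
    using nrm_null_ip d assms y by auto
  then have "ip x x = ip y x" "ip x y = ip y y" using assms y by (auto simp: ip_diff_left)
  then have "Re (ip x x) = Re (ip y y)" using ip_cnj[of x y] assms y by simp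
  then show ?thesis using y assms by (simp add: nrm_power2)
qed

lemma residual_tendsto_0:
  assumes "x \<in> S"
  shows "((\<lambda>F. nrm (x - lincomb (\<lambda>i. ip x (E i)) F)) \<longlongrightarrow> 0) (finite_subsets_at_top I)"
proof -
  have "((\<lambda>F. (nrm x)\<^sup>2 - (\<Sum>i\<in>F. (cmod (ip x (E i)))\<^sup>2)) \<longlongrightarrow> (nrm x)\<^sup>2 - (nrm x)\<^sup>2) (finite_subsets_at_top I)"
    using Parseval[OF assms] unfolding has_sum_def by (intro tendsto_intros)
  then have "((\<lambda>F. sqrt ((nrm x)\<^sup>2 - (\<Sum>i\<in>F. (cmod (ip x (E i)))\<^sup>2))) \<longlongrightarrow> sqrt 0) (finite_subsets_at_top I)"
    by (intro tendsto_real_sqrt) simp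
  moreover have "\<forall>\<^sub>F F in finite_subsets_at_top I. sqrt ((nrm x)\<^sup>2 - (\<Sum>i\<in>F. (cmod (ip x (E i)))\<^sup>2)) =
      nrm (x - lincomb (\<lambda>i. ip x (E i)) F)"
    by (rule eventually_finite_subsets_at_top_weakI)
       (use assms in \<open>simp add: nrm_diff_lincomb[symmetric] diff_mem lincomb_mem\<close>)
  ultimately show ?thesis by (simp add: tendsto_cong)
qed

text \<open>A bounded functional may be applied term by term to the expansion of \<open>x\<close>:
  the error is its value on the residual, at most \<open>C\<close> times a norm that tends to
  0.\<close>

lemma functional_has_sum:
  assumes add: "\<And>x y. x \<in> S \<Longrightarrow> y \<in> S \<Longrightarrow> \<phi> (x + y) = \<phi> x + \<phi> y"
    and scl: "\<And>c x. x \<in> S \<Longrightarrow> \<phi> (scl c x) = c * \<phi> x"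
    and bdd: "\<And>x. x \<in> S \<Longrightarrow> cmod (\<phi> x) \<le> C * nrm x"
    and x: "x \<in> S"
  shows "((\<lambda>i. ip x (E i) * \<phi> (E i)) has_sum \<phi> x) I"
proof -
  let ?r = "\<lambda>F. x - lincomb (\<lambda>i. ip x (E i)) F"
  have "((\<lambda>F. C * nrm (?r F)) \<longlongrightarrow> C * 0) (finite_subsets_at_top I)"
    by (intro tendsto_mult tendsto_const residual_tendsto_0 x)
  then have lim: "((\<lambda>F. C * nrm (?r F)) \<longlongrightarrow> 0) (finite_subsets_at_top I)" by simp
  have "((\<lambda>F. \<phi> x - (\<Sum>i\<in>F. ip x (E i) * \<phi> (E i))) \<longlongrightarrow> 0) (finite_subsets_at_top I)"
  proof (rule Lim_null_comparison[OF _ lim], rule eventually_finite_subsets_at_top_weakI)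
    fix F assume F: "finite F" "F \<subseteq> I"
    have "\<phi> (?r F + lincomb (\<lambda>i. ip x (E i)) F) = \<phi> (?r F) + \<phi> (lincomb (\<lambda>i. ip x (E i)) F)"
      using F x by (intro add diff_mem lincomb_mem)
    moreover have "\<phi> (lincomb (\<lambda>i. ip x (E i)) F) = (\<Sum>i\<in>F. ip x (E i) * \<phi> (E i))"
      using F unfolding lincomb_def
      by (subst additive_sum[of \<phi>]) (auto intro!: sum.cong simp: add scl scl_mem E_mem subset_iff)
    ultimately have "\<phi> x - (\<Sum>i\<in>F. ip x (E i) * \<phi> (E i)) = \<phi> (?r F)" by simp
    then show "norm (\<phi> x - (\<Sum>i\<in>F. ip x (E i) * \<phi> (E i))) \<le> C * nrm (?r F)"
      using bdd[of "?r F"] F x by (simp add: diff_mem lincomb_mem)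
  qed
  then have "((\<lambda>F. \<phi> x - (\<phi> x - (\<Sum>i\<in>F. ip x (E i) * \<phi> (E i)))) \<longlongrightarrow> \<phi> x - 0) (finite_subsets_at_top I)"
    by (intro tendsto_intros)
  then show ?thesis by (simp add: has_sum_def)
qed

lemma functional_eq_0:
  assumes "\<And>x y. x \<in> S \<Longrightarrow> y \<in> S \<Longrightarrow> \<phi> (x + y) = \<phi> x + \<phi> y"
    and "\<And>c x. x \<in> S \<Longrightarrow> \<phi> (scl c x) = c * \<phi> x"
    and "\<And>x. x \<in> S \<Longrightarrow> cmod (\<phi> x) \<le> C * nrm x"
    and "\<And>i. i \<in> I \<Longrightarrow> \<phi> (E i) = 0"
    and "x \<in> S"
  shows "\<phi> x = 0"
proof -
  have "((\<lambda>i. ip x (E i) * \<phi> (E i)) has_sum \<phi> x) I"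
    by (rule functional_has_sum[OF assms(1-3,5)])
  then have "((\<lambda>i. 0) has_sum \<phi> x) I"
    by (rule has_sum_cong[THEN iffD1, rotated]) (simp add: assms(4))
  then show ?thesis by (rule has_sum_unique) (simp add: has_sum_0)
qed

lemma ip_has_sum:
  assumes "x \<in> S" "y \<in> S"
  shows "((\<lambda>i. ip x (E i) * ip (E i) y) has_sum ip x y) I"
  by (rule functional_has_sum[where C = "nrm y"])
     (use assms in \<open>simp_all add: ip_add_left ip_scl_left Cauchy_Schwarz mult.commute[of "nrm y"]\<close>)

text \<open>The representing vector must have the coefficients \<open>cnj (\<phi> (E i))\<close>.
  Once these are square summable, Riesz-Fischer yields \<open>z\<close>, and \<phi> and
  \<open>ip\<close> with \<open>z\<close> are bounded functionals that agree on the family.\<close>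

lemma Riesz_representation:
  assumes add: "\<And>x y. x \<in> S \<Longrightarrow> y \<in> S \<Longrightarrow> \<phi> (x + y) = \<phi> x + \<phi> y"
    and scl: "\<And>c x. x \<in> S \<Longrightarrow> \<phi> (scl c x) = c * \<phi> x"
    and bdd: "\<And>x. x \<in> S \<Longrightarrow> cmod (\<phi> x) \<le> C * nrm x"
  obtains z where "z \<in> S" "\<And>x. x \<in> S \<Longrightarrow> \<phi> x = ip x z"
proof -
  define c where "c i = cnj (\<phi> (E i))" for i
  have bound: "(\<Sum>i\<in>F. (cmod (c i))\<^sup>2) \<le> C\<^sup>2" if F: "finite F" "F \<subseteq> I" for F
  proof -
    let ?s = "\<Sum>i\<in>F. (cmod (c i))\<^sup>2"
    have l: "lincomb c F \<in> S" using F by (simp add: lincomb_mem)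
    have n: "(nrm (lincomb c F))\<^sup>2 = ?s" using F l by (simp add: nrm_power2 ip_lincomb_lincomb)
    \<comment> \<open>Testing on the partial sum with the same coefficients gives a value
      \<open>s\<close> equal to its squared norm; boundedness then says that \<open>s\<close> is at
      most \<open>C\<close> times the square root of \<open>s\<close>, whence \<open>s\<close> is at
      most \<open>C^2\<close>.\<close>
    have "\<phi> (lincomb c F) = (\<Sum>i\<in>F. of_real ((cmod (c i))\<^sup>2))"
      using F unfolding lincomb_def
      by (subst additive_sum[of \<phi>]) (auto intro!: sum.cong
          simp: add scl scl_mem E_mem subset_iff c_def complex_norm_square mult.commute
          simp del: of_real_power)
    then have "\<phi> (lincomb c F) = of_real ?s" by simp
    then have "?s \<le> C * nrm (lincomb c F)"
      using bdd[OF l] by (simp add: sum_nonneg del: of_real_sum)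
    then have "?s\<^sup>2 \<le> (C * nrm (lincomb c F))\<^sup>2"
      by (intro power_mono) (auto simp: sum_nonneg)
    then have "?s * ?s \<le> C\<^sup>2 * ?s" by (simp add: power_mult_distrib n power2_eq_square[of ?s])
    moreover have "?s \<ge> 0" by (simp add: sum_nonneg)
    ultimately show ?thesis
      by (cases "?s = 0") (auto simp: mult_le_cancel_right)
  qed
  have "(\<lambda>i. (cmod (c i))\<^sup>2) summable_on I"
    by (rule nonneg_bdd_above_summable_on) (auto intro!: bdd_aboveI2 bound)
  then obtain z where z: "z \<in> S" "\<And>i. i \<in> I \<Longrightarrow> ip z (E i) = c i"
    using Riesz_Fischer by blast
  show thesis
  proof (rule that[OF z(1)])
    fix x assume x: "x \<in> S"
    have "\<phi> x - ip x z = 0"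
    proof (rule functional_eq_0[where C = "C + nrm z" and \<phi> = "\<lambda>x. \<phi> x - ip x z"])
      fix i assume "i \<in> I"
      then show "\<phi> (E i) - ip (E i) z = 0"
        using z ip_cnj[of z "E i"] by (simp add: E_mem c_def)
    next
      fix x assume x: "x \<in> S"
      show "cmod (\<phi> x - ip x z) \<le> (C + nrm z) * nrm x"
        using bdd[OF x] Cauchy_Schwarz[OF x z(1)] norm_triangle_ineq4[of "\<phi> x" "ip x z"]
        by (simp add: algebra_simps)
    qed (use x z in \<open>auto simp: add scl ip_add_left ip_scl_left algebra_simps\<close>)
    then show "\<phi> x = ip x z" by simp
  qed
qed

end

section \<open>Hilbert spaces\<close>

lemma hscale_zero_left: "hscale 0 (x :: 'h::hvec) = 0"
  using hscale_add_left[of 0 0 x] by simp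

lemma hscale_minus_one: "hscale (- 1) (x :: 'h::hvec) = - x"
proof -
  have "hscale (- 1) x + x = hscale (- 1 + 1) x"
    by (simp only: hscale_add_left hscale_one)
  then show ?thesis by (simp add: hscale_zero_left eq_neg_iff_add_eq_0)
qed

interpretation H: semi_hilbert "UNIV :: 'h::chilbert set" hscale hinner
proof
  fix X :: "nat \<Rightarrow> 'h"
  assume "\<forall>e>0. \<exists>N. \<forall>m\<ge>N. \<forall>n\<ge>N. sqrt (Re (hinner (X m - X n) (X m - X n))) < e"
  then show "\<exists>L\<in>UNIV. (\<lambda>n. sqrt (Re (hinner (X n - L) (X n - L)))) \<longlonglongrightarrow> 0"
    using hilbert_complete[of X] by blast
qed (auto simp: hscale_minus_one hinner_add_left hinner_hscale_left hinner_nonneg intro: hinner_cnj)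

lemma hnorm_eq: "hnorm = (H.nrm :: 'h::chilbert \<Rightarrow> real)"
  by (simp add: fun_eq_iff hnorm_def H.nrm_def)

lemma H_nrm_eq_0: "H.nrm (x :: 'h::chilbert) = 0 \<longleftrightarrow> x = 0"
  using H.ip_self[of x] hinner_eq_zero[of x] by auto

lemma hinner_eqI:
  assumes "\<And>y. hinner x y = hinner (x' :: 'h::chilbert) y"
  shows "x = x'"
proof -
  have "hinner (x - x') (x - x') = 0" using assms by (simp add: H.ip_diff_left)
  then show ?thesis by (simp add: hinner_eq_zero)
qed

lemma hinner_eqI_right:
  assumes "\<And>y. hinner y x = hinner y (x' :: 'h::chilbert)"
  shows "x = x'"
  using assms by (intro hinner_eqI) (metis hinner_cnj)

text \<open>Zorn's lemma gives a maximal orthonormal set; a nonzero vector orthogonal to it could be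
  normalized and adjoined.\<close>

lemma ex_orthonormal_basis: "\<exists>B :: 'h::chilbert set. orthonormal_basis B"
proof -
  define \<A> where "\<A> = {B :: 'h set. (\<forall>e\<in>B. hinner e e = 1) \<and>
    (\<forall>e\<in>B. \<forall>f\<in>B. e \<noteq> f \<longrightarrow> hinner e f = 0)}"
  have "\<exists>M\<in>\<A>. \<forall>X\<in>\<A>. M \<subseteq> X \<longrightarrow> X = M"
  proof (rule subset_Zorn_nonempty)
    show "\<A> \<noteq> {}" by (auto simp: \<A>_def)
  next
    fix \<C> assume C: "\<C> \<noteq> {}" "subset.chain \<A> \<C>"
    have "hinner e f = 0" if ef: "e \<in> X" "X \<in> \<C>" "f \<in> Y" "Y \<in> \<C>" "e \<noteq> f" for e f X Y
    proof -
      have "X \<subseteq> Y \<or> Y \<subseteq> X" using C ef by (auto simp: subset.chain_def)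
      moreover have "X \<in> \<A>" "Y \<in> \<A>" using C ef by (auto simp: subset.chain_def)
      ultimately show ?thesis using ef by (auto simp: \<A>_def)
    qed
    moreover have "hinner e e = 1" if "e \<in> X" "X \<in> \<C>" for e X
      using C that by (auto simp: subset.chain_def \<A>_def)
    ultimately show "\<Union>\<C> \<in> \<A>" by (auto simp: \<A>_def)
  qed
  then obtain M where M: "M \<in> \<A>" "\<And>X. X \<in> \<A> \<Longrightarrow> M \<subseteq> X \<Longrightarrow> X = M" by blast
  have "x = 0" if x: "\<forall>e\<in>M. hinner x e = 0" for x
  proof (rule ccontr)
    assume "x \<noteq> 0"
    then have n: "H.nrm x \<noteq> 0" by (simp add: H_nrm_eq_0)
    define y where "y = hscale (of_real (inverse (H.nrm x))) x"
    have y1: "hinner y y = 1"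
      using n by (simp add: y_def hinner_hscale_left H.ip_scl_right H.ip_self power2_eq_square field_simps)
    have y0: "hinner y e = 0" "hinner e y = 0" if "e \<in> M" for e
      using x that hinner_cnj[of x e] by (auto simp: y_def hinner_hscale_left H.ip_scl_right)
    have "insert y M \<in> \<A>"
      using M(1) y1 y0 by (auto simp: \<A>_def)
    then have "y \<in> M" using M(2)[of "insert y M"] by blast
    then show False using y0 y1 by force
  qed
  then have "orthonormal_basis M" using M(1) by (auto simp: orthonormal_basis_def \<A>_def)
  then show ?thesis ..
qed

lemma orthonormal_basis_complete_family:
  assumes "orthonormal_basis (B :: 'h::chilbert set)"
  shows "complete_orthonormal_family UNIV hscale hinner B (\<lambda>e. e)"
  using assms by unfold_locales (auto simp: orthonormal_basis_def H_nrm_eq_0)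

section \<open>Square integrable functions\<close>

text \<open>Measurability is demanded separately, since integrability of the squared modulus says
  nothing about the phase.\<close>

definition L2 :: "'a measure \<Rightarrow> ('a \<Rightarrow> complex) set" where
  "L2 M = {f \<in> borel_measurable M. integrable M (\<lambda>x. (cmod (f x))\<^sup>2)}"

definition l2_scale :: "complex \<Rightarrow> ('a \<Rightarrow> complex) \<Rightarrow> 'a \<Rightarrow> complex" where
  "l2_scale c f = (\<lambda>x. c * f x)"

definition l2_inner :: "'a measure \<Rightarrow> ('a \<Rightarrow> complex) \<Rightarrow> ('a \<Rightarrow> complex) \<Rightarrow> complex" where
  "l2_inner M f g = (LINT x|M. f x * cnj (g x))"

lemma L2_integrable: "f \<in> L2 M \<Longrightarrow> integrable M (\<lambda>x. (cmod (f x))\<^sup>2)"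
  by (simp add: L2_def)

lemma L2_add:
  assumes "f \<in> L2 M" "g \<in> L2 M"
  shows "f + g \<in> L2 M"
proof -
  have [measurable]: "f \<in> borel_measurable M" "g \<in> borel_measurable M"
    using assms by (auto simp: L2_def)
  have "integrable M (\<lambda>x. (cmod (f x + g x))\<^sup>2)"
  proof (rule Bochner_Integration.integrable_bound)
    show "integrable M (\<lambda>x. 2 * (cmod (f x))\<^sup>2 + 2 * (cmod (g x))\<^sup>2)"
      using assms by (auto simp: L2_def)
    show "AE x in M. norm ((cmod (f x + g x))\<^sup>2) \<le> norm (2 * (cmod (f x))\<^sup>2 + 2 * (cmod (g x))\<^sup>2)"
    proof (rule AE_I2)
      fix x
      have "(cmod (f x + g x))\<^sup>2 \<le> (cmod (f x) + cmod (g x))\<^sup>2"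
        by (intro power_mono norm_triangle_ineq) simp
      also have "\<dots> \<le> 2 * (cmod (f x))\<^sup>2 + 2 * (cmod (g x))\<^sup>2"
        using zero_le_power2[of "cmod (f x) - cmod (g x)"] by (simp add: power2_sum power2_diff)
      finally show "norm ((cmod (f x + g x))\<^sup>2) \<le> norm (2 * (cmod (f x))\<^sup>2 + 2 * (cmod (g x))\<^sup>2)" by simp
    qed
  qed simp
  then show ?thesis by (simp add: L2_def plus_fun_def)
qed

lemma L2_scale: "f \<in> L2 M \<Longrightarrow> l2_scale c f \<in> L2 M"
  by (auto simp: L2_def l2_scale_def norm_mult power_mult_distrib)

lemma L2_mult_integrable:
  assumes "f \<in> L2 M" "g \<in> L2 M"
  shows "integrable M (\<lambda>x. f x * g x)"
proof (rule Bochner_Integration.integrable_bound)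
  have [measurable]: "f \<in> borel_measurable M" "g \<in> borel_measurable M"
    using assms by (auto simp: L2_def)
  show "integrable M (\<lambda>x. (cmod (f x))\<^sup>2 + (cmod (g x))\<^sup>2)"
    using assms by (auto simp: L2_def)
  show "(\<lambda>x. f x * g x) \<in> borel_measurable M" by measurable
  show "AE x in M. norm (f x * g x) \<le> norm ((cmod (f x))\<^sup>2 + (cmod (g x))\<^sup>2)"
  proof (rule AE_I2)
    fix x
    have "0 \<le> (cmod (f x) - cmod (g x))\<^sup>2" "0 \<le> cmod (f x) * cmod (g x)" by auto
    then have "cmod (f x) * cmod (g x) \<le> (cmod (f x))\<^sup>2 + (cmod (g x))\<^sup>2"
      unfolding power2_diff by linarith
    then show "norm (f x * g x) \<le> norm ((cmod (f x))\<^sup>2 + (cmod (g x))\<^sup>2)" by (simp add: norm_mult)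
  qed
qed

lemma L2_cnj: "f \<in> L2 M \<Longrightarrow> (\<lambda>x. cnj (f x)) \<in> L2 M"
  using measurable_compose[of f M borel cnj borel,
      OF _ borel_measurable_continuous_onI[OF continuous_on_cnj[OF continuous_on_id]]]
  by (simp add: L2_def)

lemma L2_inner_integrable: "f \<in> L2 M \<Longrightarrow> g \<in> L2 M \<Longrightarrow> integrable M (\<lambda>x. f x * cnj (g x))"
  using L2_mult_integrable L2_cnj by blast

lemma l2_inner_self: "l2_inner M f f = of_real (LINT x|M. (cmod (f x))\<^sup>2)"
  by (simp add: l2_inner_def flip: complex_norm_square integral_complex_of_real)

lemma L2_uminus: "f \<in> L2 M \<Longrightarrow> - f \<in> L2 M"
  by (auto simp: L2_def fun_Compl_def)

lemma L2_diff: "f \<in> L2 M \<Longrightarrow> g \<in> L2 M \<Longrightarrow> f - g \<in> L2 M"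
  using L2_add[of f M "- g"] L2_uminus[of g M] by simp

text \<open>Fatou's lemma for the squared moduli. It serves twice: for completeness, and to compare
  a representing function with the pointwise limit of the trace series.\<close>

lemma L2_Fatou:
  assumes F: "\<And>j. F j \<in> L2 M" and f: "f \<in> borel_measurable M"
    and lim: "AE x in M. (\<lambda>j. F j x) \<longlonglongrightarrow> f x"
    and bound: "\<forall>\<^sub>F j in sequentially. (LINT x|M. (cmod (F j x))\<^sup>2) \<le> c"
  shows "f \<in> L2 M" "(LINT x|M. (cmod (f x))\<^sup>2) \<le> c"
proof -
  have [measurable]: "\<And>j. F j \<in> borel_measurable M" "f \<in> borel_measurable M"
    using F f by (auto simp: L2_def)
  obtain j where j: "(LINT x|M. (cmod (F j x))\<^sup>2) \<le> c"
    using bound by (auto simp: eventually_sequentially)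
  moreover have "0 \<le> (LINT x|M. (cmod (F j x))\<^sup>2)" by simp
  ultimately have c: "c \<ge> 0" by linarith
  have "(\<integral>\<^sup>+x. ennreal ((cmod (f x))\<^sup>2) \<partial>M) = (\<integral>\<^sup>+x. liminf (\<lambda>j. ennreal ((cmod (F j x))\<^sup>2)) \<partial>M)"
  proof (rule nn_integral_cong_AE, use lim in eventually_elim)
    fix x assume "(\<lambda>j. F j x) \<longlonglongrightarrow> f x"
    then have "(\<lambda>j. ennreal ((cmod (F j x))\<^sup>2)) \<longlonglongrightarrow> ennreal ((cmod (f x))\<^sup>2)"
      by (intro tendsto_ennrealI tendsto_intros)
    then show "ennreal ((cmod (f x))\<^sup>2) = liminf (\<lambda>j. ennreal ((cmod (F j x))\<^sup>2))"
      by (intro lim_imp_Liminf[symmetric]) auto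
  qed
  also have "\<dots> \<le> liminf (\<lambda>j. \<integral>\<^sup>+x. ennreal ((cmod (F j x))\<^sup>2) \<partial>M)"
    by (rule nn_integral_liminf) simp
  also have "\<dots> = liminf (\<lambda>j. ennreal (LINT x|M. (cmod (F j x))\<^sup>2))"
    using F by (simp add: nn_integral_eq_integral L2_integrable)
  also have "\<dots> \<le> limsup (\<lambda>j. ennreal (LINT x|M. (cmod (F j x))\<^sup>2))"
    by (rule Liminf_le_Limsup) simp
  also have "\<dots> \<le> ennreal c"
    using bound by (intro Limsup_bounded) (auto elim!: eventually_mono intro: ennreal_leI)
  finally have le: "(\<integral>\<^sup>+x. ennreal ((cmod (f x))\<^sup>2) \<partial>M) \<le> ennreal c" .
  then have int: "integrable M (\<lambda>x. (cmod (f x))\<^sup>2)"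
    by (intro integrableI_bounded) (auto intro: le_less_trans)
  then show "f \<in> L2 M" by (simp add: L2_def)
  show "(LINT x|M. (cmod (f x))\<^sup>2) \<le> c"
    using le int c by (simp add: nn_integral_eq_integral)
qed

text \<open>Weighting the squared increments by \<open>2 ^ k\<close> still leaves a finite total
  integral, so the weighted series converges almost everywhere. This makes the increments themselves
  absolutely summable.\<close>

lemma L2_fast_Cauchy_converges_AE:
  assumes Y: "\<And>k. Y k \<in> L2 M"
    and d: "\<And>k. (LINT x|M. (cmod (Y (Suc k) x - Y k x))\<^sup>2) \<le> (1/4) ^ k"
  shows "AE x in M. convergent (\<lambda>k. Y k x)"
proof -
  have [measurable]: "\<And>k. Y k \<in> borel_measurable M" using Y by (auto simp: L2_def)
  let ?d = "\<lambda>k x. Y (Suc k) x - Y k x"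
  have int: "integrable M (\<lambda>x. (cmod (?d k x))\<^sup>2)" for k
    using L2_diff[OF Y[of "Suc k"] Y[of k]] by (simp add: L2_def fun_diff_def)
  let ?g = "\<lambda>k x. 2 ^ k * (cmod (?d k x))\<^sup>2"
  have "(\<integral>\<^sup>+x. (\<Sum>k. ennreal (?g k x)) \<partial>M) = (\<Sum>k. \<integral>\<^sup>+x. ennreal (?g k x) \<partial>M)"
    by (rule nn_integral_suminf) simp
  also have "\<dots> = (\<Sum>k. ennreal (2 ^ k * (LINT x|M. (cmod (?d k x))\<^sup>2)))"
    using int by (simp add: nn_integral_eq_integral)
  also have "\<dots> \<le> (\<Sum>k. ennreal ((1/2) ^ k))"
  proof (intro suminf_le ennreal_leI summableI)
    fix k
    have "2 ^ k * (LINT x|M. (cmod (?d k x))\<^sup>2) \<le> 2 ^ k * (1/4) ^ k"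
      using d[of k] by (intro mult_left_mono) auto
    also have "\<dots> = (1/2) ^ k" by (simp flip: power_mult_distrib)
    finally show "2 ^ k * (LINT x|M. (cmod (?d k x))\<^sup>2) \<le> (1/2) ^ k" .
  qed
  also have "\<dots> = ennreal (\<Sum>k. (1/2) ^ k)"
    by (intro suminf_ennreal2) (auto intro!: summable_geometric)
  also have "\<dots> < \<infinity>" by simp
  finally have "AE x in M. (\<Sum>k. ennreal (?g k x)) \<noteq> \<infinity>"
    by (intro nn_integral_PInf_AE) auto
  then show ?thesis
  proof eventually_elim
    fix x assume "(\<Sum>k. ennreal (?g k x)) \<noteq> \<infinity>"
    then have "summable (\<lambda>k. ?g k x)" by (intro summable_suminf_not_top) auto
    then have s: "summable (\<lambda>k. (1/2) ^ k + ?g k x)"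
      by (intro summable_add summable_geometric) auto
    have "summable (\<lambda>k. norm (?d k x))"
    proof (rule summable_comparison_test'[OF s])
      fix k :: nat
      let ?c = "cmod (?d k x)"
      \<comment> \<open>The square compares an increment \<open>c\<close> with its weighted square:
        \<open>c\<close> is at most \<open>(1/2) ^ k + 2 ^ k * c^2\<close>, a summable
        majorant.\<close>
      have "0 \<le> (1 - 2 ^ k * ?c)\<^sup>2" by simp
      then have "2 * (2 ^ k * ?c) \<le> 1 + 2 ^ k * (2 ^ k * ?c\<^sup>2)"
        by (simp add: power2_eq_square algebra_simps)
      then have "2 ^ k * ?c \<le> 1 + 2 ^ k * (2 ^ k * ?c\<^sup>2)"
        by (smt (verit) norm_ge_zero mult_nonneg_nonneg zero_le_power)
      then have "(1/2) ^ k * (2 ^ k * ?c) \<le> (1/2) ^ k * (1 + 2 ^ k * (2 ^ k * ?c\<^sup>2))"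
        by (intro mult_left_mono) auto
      then have "?c \<le> (1/2) ^ k + 2 ^ k * ?c\<^sup>2" by (simp add: power_one_over field_simps)
      then show "norm (norm (?d k x)) \<le> (1/2) ^ k + ?g k x" by simp
    qed
    then have "summable (\<lambda>k. ?d k x)" by (rule summable_norm_cancel)
    then have "convergent (\<lambda>n. \<Sum>k<n. ?d k x)" by (simp add: summable_iff_convergent)
    then have "convergent (\<lambda>n. (Y n x - Y 0 x))" by (simp only: sum_lessThan_telescope[of "\<lambda>k. Y k x"])
    then have "convergent (\<lambda>n. (Y n x - Y 0 x) + Y 0 x)" by (intro convergent_add convergent_const)
    then show "convergent (\<lambda>k. Y k x)" by simp
  qed
qed

text \<open>A fast subsequence converges almost everywhere, and Fatou along it, with the first index
  held fixed, turns the Cauchy estimate into an estimate against the limit.\<close>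

lemma L2_complete:
  assumes X: "\<And>n. X n \<in> L2 M"
    and Cauchy: "\<forall>e>0. \<exists>N. \<forall>m\<ge>N. \<forall>n\<ge>N. (LINT x|M. (cmod (X m x - X n x))\<^sup>2) < e"
  shows "\<exists>L\<in>L2 M. (\<lambda>n. LINT x|M. (cmod (X n x - L x))\<^sup>2) \<longlonglongrightarrow> 0"
proof -
  have [measurable]: "\<And>k. X k \<in> borel_measurable M" using X by (auto simp: L2_def)
  obtain N where N: "\<And>k m n. m \<ge> N k \<Longrightarrow> n \<ge> N k \<Longrightarrow> (LINT x|M. (cmod (X m x - X n x))\<^sup>2) < (1/4) ^ k"
    using Cauchy[rule_format, of "(1/4) ^ k" for k] by simp metis
  \<comment> \<open>Partial sums give a monotone majorant of \<open>N\<close>, so that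
    \<open>r k\<close> and \<open>r (Suc k)\<close> both lie beyond \<open>N k\<close>.\<close>
  define r where "r k = (\<Sum>i\<le>k. N i)" for k
  have rN: "N i \<le> r k" if "i \<le> k" for i k
    unfolding r_def using that by (intro member_le_sum) auto
  define Y where "Y k = X (r k)" for k
  have Y: "Y k \<in> L2 M" for k by (simp add: Y_def X)
  have conv: "AE x in M. convergent (\<lambda>k. Y k x)"
  proof (rule L2_fast_Cauchy_converges_AE[OF Y])
    fix k show "(LINT x|M. (cmod (Y (Suc k) x - Y k x))\<^sup>2) \<le> (1/4) ^ k"
      unfolding Y_def by (rule less_imp_le, rule N) (auto intro: rN)
  qed
  \<comment> \<open>On the null set where the sequence diverges, \<open>lim\<close> has one fixed
    unspecified value, and the function is measurable all the same.\<close>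
  define L where "L x = lim (\<lambda>k. Y k x)" for x
  have L[measurable]: "L \<in> borel_measurable M"
    unfolding L_def[abs_def] Y_def by (rule borel_measurable_lim_metric) simp
  have lim: "AE x in M. (\<lambda>k. Y k x) \<longlonglongrightarrow> L x"
    using conv unfolding L_def by eventually_elim (simp add: convergent_LIMSEQ_iff)
  have diff: "(\<lambda>x. X n x - L x) \<in> L2 M \<and> (LINT x|M. (cmod (X n x - L x))\<^sup>2) \<le> (1/4) ^ k" if n: "n \<ge> N k" for n k
  proof -
    have F: "(\<lambda>x. X n x - Y j x) \<in> L2 M" for j
      using L2_diff[OF X[of n] Y[of j]] by (simp add: fun_diff_def)
    have l: "AE x in M. (\<lambda>j. X n x - Y j x) \<longlonglongrightarrow> X n x - L x"
      using lim by eventually_elim (intro tendsto_intros)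
    have b: "\<forall>\<^sub>F j in sequentially. (LINT x|M. (cmod (X n x - Y j x))\<^sup>2) \<le> (1/4) ^ k"
      using eventually_ge_at_top[of k]
      by eventually_elim (unfold Y_def, rule less_imp_le, rule N, auto intro: rN n)
    show ?thesis
      using L2_Fatou[of "\<lambda>j x. X n x - Y j x", OF F _ l b] by simp
  qed
  \<comment> \<open>This difference is \<open>L\<close> itself, written with two functions known to
    be square integrable.\<close>
  have "X (N 0) - (\<lambda>x. X (N 0) x - L x) \<in> L2 M"
    using diff[of 0 "N 0"] by (intro L2_diff X) auto
  then have "L \<in> L2 M" by (simp add: fun_diff_def)
  moreover have "(\<lambda>n. LINT x|M. (cmod (X n x - L x))\<^sup>2) \<longlonglongrightarrow> 0"
  proof (rule LIMSEQ_I)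
    fix e :: real assume "e > 0"
    then obtain k where k: "(1/4) ^ k < e" using real_arch_pow_inv[of e "1/4"] by auto
    show "\<exists>no. \<forall>n\<ge>no. norm ((LINT x|M. (cmod (X n x - L x))\<^sup>2) - 0) < e"
      using diff[of k] k by (intro exI[of _ "N k"]) (auto intro: le_less_trans)
  qed
  ultimately show ?thesis by blast
qed

lemma L2_semi_hilbert: "semi_hilbert (L2 M) l2_scale (l2_inner M)"
proof
  fix f g h assume "f \<in> L2 M" "g \<in> L2 M" "h \<in> L2 M"
  then show "l2_inner M (f + g) h = l2_inner M f h + l2_inner M g h"
    by (simp add: l2_inner_def distrib_right L2_inner_integrable)
next
  fix f g :: "'a \<Rightarrow> complex"
  show "l2_inner M g f = cnj (l2_inner M f g)"
    unfolding l2_inner_def by (subst Bochner_Integration.integral_cnj[symmetric]) (simp add: mult.commute)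
next
  fix X :: "nat \<Rightarrow> 'a \<Rightarrow> complex"
  assume X: "\<And>n. X n \<in> L2 M"
    and C: "\<forall>e>0. \<exists>N. \<forall>m\<ge>N. \<forall>n\<ge>N. sqrt (Re (l2_inner M (X m - X n) (X m - X n))) < e"
  have C': "\<forall>e>0. \<exists>N. \<forall>m\<ge>N. \<forall>n\<ge>N. (LINT x|M. (cmod (X m x - X n x))\<^sup>2) < e"
  proof (intro allI impI)
    fix e :: real assume "e > 0"
    then have "\<exists>N. \<forall>m\<ge>N. \<forall>n\<ge>N. sqrt (Re (l2_inner M (X m - X n) (X m - X n))) < sqrt e"
      using C[rule_format, of "sqrt e"] by simp
    then show "\<exists>N. \<forall>m\<ge>N. \<forall>n\<ge>N. (LINT x|M. (cmod (X m x - X n x))\<^sup>2) < e"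
      by (simp add: l2_inner_self)
  qed
  obtain L where L: "L \<in> L2 M" "(\<lambda>n. LINT x|M. (cmod (X n x - L x))\<^sup>2) \<longlonglongrightarrow> 0"
    using L2_complete[OF X C'] by (elim bexE)
  have "(\<lambda>n. sqrt (LINT x|M. (cmod (X n x - L x))\<^sup>2)) \<longlonglongrightarrow> sqrt 0"
    by (intro tendsto_real_sqrt L)
  then show "\<exists>L\<in>L2 M. (\<lambda>n. sqrt (Re (l2_inner M (X n - L) (X n - L)))) \<longlonglongrightarrow> 0"
    using L(1) by (intro bexI[of _ L]) (auto simp: l2_inner_self)
next
  show "0 \<in> L2 M" by (simp add: L2_def zero_fun_def)
next
  fix c and f g :: "'a \<Rightarrow> complex"
  show "l2_inner M (l2_scale c f) g = c * l2_inner M f g"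
    by (simp add: l2_inner_def l2_scale_def mult.assoc)
qed (auto simp: L2_add L2_scale[unfolded l2_scale_def] l2_scale_def fun_Compl_def l2_inner_self)

interpretation L2: semi_hilbert "L2 M" l2_scale "l2_inner M" for M
  by (rule L2_semi_hilbert)

lemma L2_nrm_power2: "(L2.nrm M f)\<^sup>2 = (LINT x|M. (cmod (f x))\<^sup>2)"
  by (simp add: L2.nrm_def l2_inner_self)

lemma L2_nrm_eq_0:
  assumes "f \<in> L2 M"
  shows "L2.nrm M f = 0 \<longleftrightarrow> (AE x in M. f x = 0)"
proof -
  have "L2.nrm M f = 0 \<longleftrightarrow> (LINT x|M. (cmod (f x))\<^sup>2) = 0"
    by (simp add: L2.nrm_def l2_inner_self)
  also have "\<dots> \<longleftrightarrow> (AE x in M. (cmod (f x))\<^sup>2 = 0)"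
    using assms by (intro integral_nonneg_eq_0_iff_AE) (auto simp: L2_integrable)
  finally show ?thesis by simp
qed

section \<open>Coefficients of a square integrable representation\<close>

text \<open>Boundedness carries the vanishing from basis vectors to all vectors, one argument at a
  time. The second argument is conjugate-linear, so the conjugated form is the functional treated
  there.\<close>

lemma bounded_form_eq_0:
  fixes \<beta> :: "'h::chilbert \<Rightarrow> 'h \<Rightarrow> complex"
  assumes B: "orthonormal_basis B"
    and add_left: "\<And>p p' q. \<beta> (p + p') q = \<beta> p q + \<beta> p' q"
    and scale_left: "\<And>c p q. \<beta> (hscale c p) q = c * \<beta> p q"
    and add_right: "\<And>p q q'. \<beta> p (q + q') = \<beta> p q + \<beta> p q'"
    and scale_right: "\<And>c p q. \<beta> p (hscale c q) = cnj c * \<beta> p q"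
    and bound: "\<And>p q. cmod (\<beta> p q) \<le> C * H.nrm p * H.nrm q"
    and zero: "\<And>e f. e \<in> B \<Longrightarrow> f \<in> B \<Longrightarrow> \<beta> e f = 0"
  shows "\<beta> p q = 0"
proof -
  interpret B: complete_orthonormal_family UNIV hscale hinner B "\<lambda>e. e"
    using B by (rule orthonormal_basis_complete_family)
  have e: "\<beta> e q = 0" if "e \<in> B" for e
  proof -
    have "cnj (\<beta> e q) = 0"
    proof (rule B.functional_eq_0[where \<phi> = "\<lambda>q. cnj (\<beta> e q)" and C = "C * H.nrm e"])
      show "cmod (cnj (\<beta> e x)) \<le> C * H.nrm e * H.nrm x" for x using bound[of e x] by simp
    qed (simp_all add: add_right scale_right zero that)
    then show ?thesis by simp
  qed
  show ?thesis
  proof (rule B.functional_eq_0[where \<phi> = "\<lambda>p. \<beta> p q" and C = "C * H.nrm q"])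
    show "cmod (\<beta> x q) \<le> C * H.nrm q * H.nrm x" for x using bound[of x q] by (simp add: mult_ac)
  qed (simp_all add: add_left scale_left e)
qed

locale square_integrable_rep =
  fixes \<mu> :: "'a::{ab_group_add, t2_space} measure"
    and m :: "'a \<Rightarrow> 'a \<Rightarrow> complex"
    and U :: "'a \<Rightarrow> 'h::chilbert \<Rightarrow> 'h"
  assumes haar: "haar_measure \<mu>"
    and mult: "multiplier m"
    and rep: "proj_rep_sq \<mu> m U"
    and normalized: "haar_normalized \<mu> U"
begin

lemma sets_mu [measurable_cong]: "sets \<mu> = sets borel"
  using haar by (simp add: haar_measure_def)

lemma space_mu [simp]: "space \<mu> = UNIV"
  using sets_eq_imp_space_eq[OF sets_mu] by simp

lemma U_unitary: "unitary_op (U x)"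
  using rep by (simp add: proj_rep_sq_def)

lemma U_add: "U x (p + q) = U x p + U x q"
  using U_unitary by (simp add: unitary_op_def clinear_def)

lemma U_scale: "U x (hscale c p) = hscale c (U x p)"
  using U_unitary by (simp add: unitary_op_def clinear_def)

lemma U_inner: "hinner (U x p) (U x q) = hinner p q"
  using U_unitary by (simp add: unitary_op_def)

lemma U_nrm [simp]: "H.nrm (U x p) = H.nrm p"
  by (simp add: H.nrm_def U_inner)

lemma m_nonzero [simp]: "m x y \<noteq> 0"
  using mult by (metis multiplier_def norm_zero zero_neq_one)

lemma U_U: "U x (U y p) = hscale (m x y) (U (x + y) p)"
  using rep by (simp add: proj_rep_sq_def fun_eq_iff)

text \<open>As the group is commutative, \<open>U x\<close> composed with \<open>U y\<close> in
  either order is a multiple of \<open>U (x + y)\<close>; the ratio of the two factors is the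
  symplectic character.\<close>

lemma U_conjugation: "hinner (U x (U y p)) (U y q) = sympl m x y * hinner (U x p) q"
proof -
  have "hscale (m y x) (U x (U y p)) = hscale (m x y) (U y (U x p))"
    by (simp add: U_U hscale_hscale add.commute mult.commute)
  then have "hinner (hscale (m y x) (U x (U y p))) (U y q) = hinner (hscale (m x y) (U y (U x p))) (U y q)"
    by simp
  then have "m y x * hinner (U x (U y p)) (U y q) = m x y * hinner (U x p) q"
    by (simp add: hinner_hscale_left U_inner)
  then show ?thesis by (simp add: sympl_def field_simps)
qed

lemma coeff_bound: "cmod (hinner (U x p) q) \<le> H.nrm p * H.nrm q"
  using H.Cauchy_Schwarz[of "U x p" q] by simp

lemma coeff_continuous: "continuous_on UNIV (\<lambda>x. hinner (U x p) q)"
  unfolding continuous_on_eq_continuous_at[OF open_UNIV]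
proof (intro ballI)
  fix x0 :: 'a
  show "isCont (\<lambda>x. hinner (U x p) q) x0"
    unfolding isCont_def
  proof (rule tendstoI)
    fix e :: real assume e: "e > 0"
    define d where "d = e / (H.nrm q + 1)"
    have q: "H.nrm q \<ge> 0" by simp
    then have d: "d > 0" using e unfolding d_def by (intro divide_pos_pos) linarith+
    obtain V where V: "open V" "x0 \<in> V" "\<And>x. x \<in> V \<Longrightarrow> H.nrm (U x p - U x0 p) < d"
      using rep d unfolding proj_rep_sq_def hnorm_eq by metis
    have "dist (hinner (U x p) q) (hinner (U x0 p) q) < e" if "x \<in> V" for x
    proof -
      have "cmod (hinner (U x p - U x0 p) q) \<le> H.nrm (U x p - U x0 p) * H.nrm q"
        by (rule H.Cauchy_Schwarz) auto
      also have "\<dots> \<le> d * H.nrm q"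
        using V(3)[OF that] q by (intro mult_right_mono) auto
      also have "\<dots> < d * (H.nrm q + 1)" using d by simp
      also have "\<dots> = e" using add_nonneg_pos[OF q zero_less_one] by (simp add: d_def)
      finally show ?thesis by (simp add: dist_norm H.ip_diff_left)
    qed
    then show "\<forall>\<^sub>F x in at x0. dist (hinner (U x p) q) (hinner (U x0 p) q) < e"
      unfolding eventually_at_topological using V by blast
  qed
qed

lemma coeff_measurable [measurable]: "(\<lambda>x. hinner (U x p) q) \<in> borel_measurable \<mu>"
  using borel_measurable_continuous_onI[OF coeff_continuous] measurable_cong_sets[OF sets_mu refl]
  by blast

text \<open>The conjugate makes \<open>l2_inner \<mu> g (mc p q)\<close> the integral of
  \<open>g\<close> against the coefficient itself, hence linear in \<open>p\<close> and
  conjugate-linear in \<open>q\<close>, as \<open>hinner (A p) q\<close> is.\<close>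

definition mc :: "'h \<Rightarrow> 'h \<Rightarrow> 'a \<Rightarrow> complex" where
  "mc p q = (\<lambda>x. cnj (hinner (U x p) q))"

lemma l2_inner_mc: "l2_inner \<mu> g (mc p q) = (LINT x|\<mu>. g x * hinner (U x p) q)"
  by (simp add: l2_inner_def mc_def)

lemma coeff_L2: "(\<lambda>x. hinner (U x p) q) \<in> L2 \<mu>"
proof -
  have "integrable \<mu> (\<lambda>x. hinner (U x p) q * cnj (hinner (U x p) q))"
    using normalized unfolding haar_normalized_def by blast
  then have "integrable \<mu> (\<lambda>x. cmod (hinner (U x p) q * cnj (hinner (U x p) q)))"
    by (rule integrable_norm)
  then show ?thesis by (simp add: L2_def norm_mult power2_eq_square)
qed

lemma mc_L2: "mc p q \<in> L2 \<mu>"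
  unfolding mc_def by (intro L2_cnj coeff_L2)

lemma l2_inner_mc_mc: "l2_inner \<mu> (mc p q) (mc p' q') = hinner p' p * hinner q q'"
proof -
  have "l2_inner \<mu> (mc p q) (mc p' q') =
      (LINT x|\<mu>. hinner (U x p') q' * cnj (hinner (U x p) q))"
    by (simp add: l2_inner_def mc_def mult.commute)
  also have "\<dots> = hinner p' p * cnj (hinner q' q)"
    using normalized unfolding haar_normalized_def by blast
  finally show ?thesis using hinner_cnj[of q' q] by simp
qed

lemma nrm_mc: "L2.nrm \<mu> (mc p q) = H.nrm p * H.nrm q"
  by (simp add: L2.nrm_def l2_inner_mc_mc H.ip_self real_sqrt_mult flip: of_real_power of_real_mult)

lemma form_bound: "g \<in> L2 \<mu> \<Longrightarrow> cmod (l2_inner \<mu> g (mc p q)) \<le> L2.nrm \<mu> g * H.nrm p * H.nrm q"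
  using L2.Cauchy_Schwarz[of g \<mu> "mc p q"] by (simp add: mc_L2 nrm_mc mult.assoc)

lemma form_linear:
  assumes "g \<in> L2 \<mu>"
  shows "l2_inner \<mu> g (mc (p + p') q) = l2_inner \<mu> g (mc p q) + l2_inner \<mu> g (mc p' q)"
    "l2_inner \<mu> g (mc (hscale c p) q) = c * l2_inner \<mu> g (mc p q)"
    "l2_inner \<mu> g (mc p (q + q')) = l2_inner \<mu> g (mc p q) + l2_inner \<mu> g (mc p q')"
    "l2_inner \<mu> g (mc p (hscale c q)) = cnj c * l2_inner \<mu> g (mc p q)"
proof -
  have 1: "mc (p + p') q = mc p q + mc p' q"
    by (simp add: mc_def U_add hinner_add_left fun_eq_iff)
  have 2: "mc (hscale c p) q = l2_scale (cnj c) (mc p q)"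
    by (simp add: mc_def U_scale hinner_hscale_left l2_scale_def)
  have 3: "mc p (q + q') = mc p q + mc p q'"
    by (simp add: mc_def H.ip_add_right fun_eq_iff)
  have 4: "mc p (hscale c q) = l2_scale c (mc p q)"
    by (simp add: mc_def H.ip_scl_right l2_scale_def)
  show "l2_inner \<mu> g (mc (p + p') q) = l2_inner \<mu> g (mc p q) + l2_inner \<mu> g (mc p' q)"
    "l2_inner \<mu> g (mc (hscale c p) q) = c * l2_inner \<mu> g (mc p q)"
    "l2_inner \<mu> g (mc p (q + q')) = l2_inner \<mu> g (mc p q) + l2_inner \<mu> g (mc p q')"
    "l2_inner \<mu> g (mc p (hscale c q)) = cnj c * l2_inner \<mu> g (mc p q)"
    using assms by (simp_all add: 1 2 3 4 L2.ip_add_right L2.ip_scl_right mc_L2)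
qed

lemma ex_nonzero: "\<exists>p :: 'h. p \<noteq> 0"
  using rep unfolding proj_rep_sq_def by (elim conjE exE) (rule exI)

text \<open>Conjugation by \<open>U \<xi>\<close> absorbs the character into the first coefficient,
  after which the orthogonality relation evaluates the integral.\<close>

lemma sfourier_coeff_product:
  "sfourier \<mu> m (\<lambda>x. hinner (U x p) q * cnj (hinner (U x p') q')) \<xi> =
    hinner (U \<xi> p) p' * cnj (hinner (U \<xi> q) q')"
proof -
  have "sfourier \<mu> m (\<lambda>x. hinner (U x p) q * cnj (hinner (U x p') q')) \<xi> =
      (LINT x|\<mu>. hinner (U x (U \<xi> p)) (U \<xi> q) * cnj (hinner (U x p') q'))"
    by (simp add: sfourier_def U_conjugation mult.assoc)
  also have "\<dots> = hinner (U \<xi> p) p' * cnj (hinner (U \<xi> q) q')"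
    using normalized unfolding haar_normalized_def by blast
  finally show ?thesis .
qed

text \<open>The scaling constant is 1 because \<open>\<bar>\<langle>U\<^sub>x p, p\<rangle>\<bar>\<^sup>2\<close> equals its own symplectic
  Fourier transform.\<close>
lemma dual_haar_eq:
  assumes "dual_haar \<mu> m \<nu>"
  shows "\<nu> = \<mu>"
proof -
  obtain c :: real where c: "c > 0" "\<nu> = scale_measure (ennreal c) \<mu>"
    using assms by (auto simp: dual_haar_def)
  obtain p :: 'h where p: "p \<noteq> 0" using ex_nonzero by blast
  define f where "f x = hinner (U x p) p * cnj (hinner (U x p) p)" for x
  have f: "integrable \<mu> f" "(LINT x|\<mu>. f x) = hinner p p * cnj (hinner p p)"
    using normalized unfolding haar_normalized_def f_def by blast+
  \<comment> \<open>\<open>f\<close> is integrable and bounded, hence also square integrable, as the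
    isometry clause of \<open>dual_haar\<close> requires.\<close>
  have f2: "integrable \<mu> (\<lambda>x. (cmod (f x))\<^sup>2)"
  proof (rule Bochner_Integration.integrable_bound)
    show "integrable \<mu> (\<lambda>x. (H.nrm p * H.nrm p)\<^sup>2 * cmod (f x))" using f by auto
    have [measurable]: "f \<in> borel_measurable \<mu>" using f by auto
    show "(\<lambda>x. (cmod (f x))\<^sup>2) \<in> borel_measurable \<mu>" by measurable
    show "AE x in \<mu>. norm ((cmod (f x))\<^sup>2) \<le> norm ((H.nrm p * H.nrm p)\<^sup>2 * cmod (f x))"
    proof (rule AE_I2)
      fix x
      have "cmod (f x) \<le> (H.nrm p * H.nrm p)\<^sup>2"
        using power_mono[OF coeff_bound[of x p p], of 2] by (simp add: f_def norm_mult power2_eq_square)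
      then have "cmod (f x) * cmod (f x) \<le> (H.nrm p * H.nrm p)\<^sup>2 * cmod (f x)"
        by (rule mult_right_mono) simp
      then show "norm ((cmod (f x))\<^sup>2) \<le> norm ((H.nrm p * H.nrm p)\<^sup>2 * cmod (f x))"
        by (simp add: power2_eq_square)
    qed
  qed
  have "sfourier \<mu> m f = f"
    unfolding f_def by (rule ext) (rule sfourier_coeff_product)
  then have "(LINT x|\<nu>. (cmod (f x))\<^sup>2) = (LINT x|\<mu>. (cmod (f x))\<^sup>2)"
    using assms f(1) f2 unfolding dual_haar_def by metis
  moreover have "(LINT x|\<nu>. (cmod (f x))\<^sup>2) = c * (LINT x|\<mu>. (cmod (f x))\<^sup>2)"
  proof -
    have [measurable]: "f \<in> borel_measurable \<mu>" using f by auto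
    have sets: "sets \<nu> = sets \<mu>" using c by simp
    have "(\<lambda>x. (cmod (f x))\<^sup>2) \<in> borel_measurable \<nu>"
      unfolding measurable_cong_sets[OF sets refl] by measurable
    then have "(LINT x|\<nu>. (cmod (f x))\<^sup>2) = enn2real (\<integral>\<^sup>+x. ennreal ((cmod (f x))\<^sup>2) \<partial>\<nu>)"
      by (intro integral_eq_nn_integral) auto
    also have "(\<integral>\<^sup>+x. ennreal ((cmod (f x))\<^sup>2) \<partial>\<nu>) = ennreal c * (\<integral>\<^sup>+x. ennreal ((cmod (f x))\<^sup>2) \<partial>\<mu>)"
      unfolding c(2) by (intro nn_integral_scale_measure) measurable
    finally show ?thesis
      using c(1) f2 by (simp add: nn_integral_eq_integral enn2real_mult)
  qed
  \<comment> \<open>Otherwise \<open>f\<close> would vanish almost everywhere, whereas its integral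
    is the fourth power of the norm of \<open>p\<close>.\<close>
  moreover have "(LINT x|\<mu>. (cmod (f x))\<^sup>2) \<noteq> 0"
  proof
    assume "(LINT x|\<mu>. (cmod (f x))\<^sup>2) = 0"
    then have "AE x in \<mu>. (cmod (f x))\<^sup>2 = 0"
      using f2 by (subst (asm) integral_nonneg_eq_0_iff_AE) auto
    then have "AE x in \<mu>. f x = 0" by simp
    then have "(LINT x|\<mu>. f x) = 0" by (simp add: integral_eq_zero_AE)
    then show False using f(2) p by (simp add: hinner_eq_zero)
  qed
  ultimately have "c = 1" by simp
  then show ?thesis using c by simp
qed

text \<open>The set \<open>W y\<close> is open by continuity and contains \<open>y\<close>, where
  the coefficient is \<open>hinner p p\<close>. Compactness leaves finitely many of these sets, so
  only finitely many exceptional null sets have to be united.\<close>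

lemma AE_zero_on_compact:
  assumes g: "\<And>p q. AE x in \<mu>. g x * hinner (U x p) q = 0" and K: "compact K"
  shows "AE x in \<mu>. x \<in> K \<longrightarrow> g x = (0::complex)"
proof -
  obtain p :: 'h where p: "p \<noteq> 0" using ex_nonzero by blast
  define W where "W y = {x. hinner (U x p) (U y p) \<noteq> 0}" for y
  have "open (W y)" for y
    unfolding W_def using coeff_continuous[of p "U y p"]
    by (intro open_Collect_neq continuous_on_const) auto
  moreover have "K \<subseteq> (\<Union>y\<in>K. W y)"
    using p by (auto simp: W_def U_inner hinner_eq_zero)
  ultimately obtain D where D: "D \<subseteq> K" "finite D" "K \<subseteq> (\<Union>y\<in>D. W y)"
    using compactE_image[OF K, of K W] by blast
  have "AE x in \<mu>. \<forall>y\<in>D. g x * hinner (U x p) (U y p) = 0"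
    using D(2) g by (intro AE_finite_allI) auto
  then show ?thesis
    by eventually_elim (use D(3) in \<open>auto simp: W_def\<close>)
qed

text \<open>Inner regularity is assumed for open sets only. So \<open>A\<close> is put into an open
  \<open>W\<close> of finite measure; for compact \<open>K\<close> inside \<open>W\<close> the set
  \<open>A\<close> lies in \<open>W - K\<close> up to a null set, and exhausting \<open>W\<close> by
  such \<open>K\<close> leaves no measure for \<open>A\<close>.\<close>

lemma null_set_if_null_on_compacts:
  assumes A: "A \<in> sets borel" "emeasure \<mu> A < \<infinity>"
    and K0: "\<And>K. compact K \<Longrightarrow> emeasure \<mu> (A \<inter> K) = 0"
  shows "emeasure \<mu> A = 0"
proof -
  have "(INF W\<in>{W. open W \<and> A \<subseteq> W}. emeasure \<mu> W) < \<infinity>"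
    using haar A unfolding haar_measure_def by metis
  then obtain W where W: "open W" "A \<subseteq> W" "emeasure \<mu> W < \<infinity>"
    by (auto simp: INF_less_iff)
  have [measurable]: "A \<in> sets \<mu>" "W \<in> sets \<mu>" using A W by (auto simp: sets_mu)
  have K: "emeasure \<mu> A + emeasure \<mu> K \<le> emeasure \<mu> W" if "compact K" "K \<subseteq> W" for K
  proof -
    have [measurable]: "K \<in> sets \<mu>"
      using that by (simp add: sets_mu compact_imp_closed)
    have "emeasure \<mu> A \<le> emeasure \<mu> ((W - K) \<union> (A \<inter> K))"
      using W by (intro emeasure_mono) auto
    also have "\<dots> \<le> emeasure \<mu> (W - K) + emeasure \<mu> (A \<inter> K)"
      by (rule emeasure_subadditive) auto
    also have "\<dots> = emeasure \<mu> (W - K)" using K0 that by simp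
    finally have "emeasure \<mu> A + emeasure \<mu> K \<le> emeasure \<mu> (W - K) + emeasure \<mu> K"
      by (rule add_right_mono)
    also have "\<dots> = emeasure \<mu> ((W - K) \<union> K)"
      by (intro plus_emeasure) auto
    also have "(W - K) \<union> K = W" using that by auto
    finally show ?thesis .
  qed
  have "emeasure \<mu> W = (SUP K\<in>{K. compact K \<and> K \<subseteq> W}. emeasure \<mu> K)"
    using haar W(1) unfolding haar_measure_def by metis
  also have "\<dots> \<le> emeasure \<mu> W - emeasure \<mu> A"
  proof (rule SUP_least)
    fix K assume "K \<in> {K. compact K \<and> K \<subseteq> W}"
    then have "emeasure \<mu> A + emeasure \<mu> K \<le> emeasure \<mu> W" using K by auto
    then show "emeasure \<mu> K \<le> emeasure \<mu> W - emeasure \<mu> A"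
      using A(2) ennreal_minus_mono[of "emeasure \<mu> A + emeasure \<mu> K" "emeasure \<mu> W" "emeasure \<mu> A" "emeasure \<mu> A"]
      by (simp add: ennreal_add_diff_cancel_left less_top)
  qed
  finally have le: "emeasure \<mu> W \<le> emeasure \<mu> W - emeasure \<mu> A" .
  have AW: "emeasure \<mu> A \<le> emeasure \<mu> W" using W by (intro emeasure_mono) auto
  \<comment> \<open>Both measures are finite, so the inequality can be read in the reals, where
    subtraction cancels.\<close>
  obtain w where w: "emeasure \<mu> W = ennreal w" "w \<ge> 0" using W(3) by (cases "emeasure \<mu> W") auto
  obtain a where a: "emeasure \<mu> A = ennreal a" "a \<ge> 0" using A(2) by (cases "emeasure \<mu> A") auto
  have "a \<le> w" using AW a w by simp
  moreover have "w \<le> w - a" using le a w \<open>a \<le> w\<close> by (simp add: ennreal_minus)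
  ultimately show ?thesis using a by simp
qed

text \<open>The group need not be \<sigma>-compact. By Markov's inequality, however, the level sets
  \<open>A n\<close> have finite measure, so being null on compact sets makes them null, and their
  union is the set where \<open>g\<close> is nonzero.\<close>

lemma AE_zero:
  assumes g: "g \<in> L2 \<mu>" and 0: "\<And>p q. AE x in \<mu>. g x * hinner (U x p) q = 0"
  shows "AE x in \<mu>. g x = 0"
proof -
  have [measurable]: "g \<in> borel_measurable \<mu>" using g by (simp add: L2_def)
  define A where "A n = {x \<in> space \<mu>. inverse (real (Suc n)) \<le> (cmod (g x))\<^sup>2}" for n
  have A[measurable]: "A n \<in> sets \<mu>" for n unfolding A_def by measurable
  have "emeasure \<mu> (A n) = 0" for n
  proof (rule null_set_if_null_on_compacts)
    show "A n \<in> sets borel" using A by (simp add: sets_mu)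
    have "emeasure \<mu> (A n) \<le> ennreal (1 / inverse (real (Suc n)) * (LINT x|\<mu>. (cmod (g x))\<^sup>2))"
      unfolding A_def using L2_integrable[OF g] by (intro integral_Markov_inequality) auto
    then show "emeasure \<mu> (A n) < \<infinity>" using le_less_trans by fastforce
  next
    fix K :: "'a set" assume K: "compact K"
    then have [measurable]: "K \<in> sets \<mu>" by (simp add: sets_mu compact_imp_closed)
    have "AE x in \<mu>. x \<notin> A n \<inter> K"
      using AE_zero_on_compact[OF 0 K] by eventually_elim (auto simp: A_def)
    then show "emeasure \<mu> (A n \<inter> K) = 0"
      by (subst (asm) AE_iff_measurable[of "A n \<inter> K"]) auto
  qed
  then have "AE x in \<mu>. x \<notin> A n" for n
    by (subst AE_iff_measurable[of "A n"]) (auto simp: A_def)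
  then have "AE x in \<mu>. \<forall>n. x \<notin> A n" by (simp add: AE_all_countable)
  then show ?thesis
  proof eventually_elim
    fix x assume x: "\<forall>n. x \<notin> A n"
    show "g x = 0"
    proof (rule ccontr)
      assume "g x \<noteq> 0"
      then obtain n where "inverse (real (Suc n)) < (cmod (g x))\<^sup>2"
        using reals_Archimedean[of "(cmod (g x))\<^sup>2"] by auto
      then have "x \<in> A n" by (simp add: A_def)
      then show False using x by blast
    qed
  qed
qed

end

section \<open>Tails of unordered sums, and adjoints of bounded operators\<close>

lemma sum_fun_apply: "(\<Sum>i\<in>I. h i) x = (\<Sum>i\<in>I. h i x :: 'b::comm_monoid_add)"
  by (induction I rule: infinite_finite_induct) auto

text \<open>Every finite \<open>G\<close> containing \<open>F\<close> gives a partial sum within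
  \<epsilon> of that over \<open>F\<close>, and the bound survives the limit. As \<open>F\<close>
  depends on the majorant \<open>a\<close> alone, the estimate is uniform over all series dominated
  by \<open>a\<close>.\<close>

lemma has_sum_tail_bound:
  fixes t :: "'i \<Rightarrow> 'b::real_normed_vector"
  assumes t: "(t has_sum S) B" and F: "finite F" "F \<subseteq> B"
    and le: "\<And>f. f \<in> B \<Longrightarrow> norm (t f) \<le> a f"
    and tail: "\<And>G. finite G \<Longrightarrow> G \<subseteq> B \<Longrightarrow> G \<inter> F = {} \<Longrightarrow> sum a G < \<epsilon>"
  shows "norm (S - sum t F) \<le> \<epsilon>"
proof (rule tendsto_upperbound)
  show "((\<lambda>G. norm (sum t G - sum t F)) \<longlongrightarrow> norm (S - sum t F)) (finite_subsets_at_top B)"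
    using t unfolding has_sum_def by (intro tendsto_intros)
  have "norm (sum t G - sum t F) \<le> \<epsilon>" if G: "finite G" "F \<subseteq> G" "G \<subseteq> B" for G
  proof -
    have "sum t G - sum t F = sum t (G - F)"
      using G by (simp add: sum_diff)
    also have "norm \<dots> \<le> (\<Sum>f\<in>G - F. norm (t f))" by (rule norm_sum)
    also have "\<dots> \<le> sum a (G - F)" using G le by (intro sum_mono) auto
    also have "\<dots> < \<epsilon>" using G by (intro tail) auto
    finally show ?thesis by simp
  qed
  then show "\<forall>\<^sub>F G in finite_subsets_at_top B. norm (sum t G - sum t F) \<le> \<epsilon>"
    unfolding eventually_finite_subsets_at_top using F by (intro exI[of _ F]) auto
qed simp

lemma has_sum_sum_finite:
  fixes f :: "'j \<Rightarrow> 'i \<Rightarrow> real"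
  assumes "finite J" "\<And>j. j \<in> J \<Longrightarrow> (f j has_sum s j) I"
  shows "((\<lambda>i. \<Sum>j\<in>J. f j i) has_sum (\<Sum>j\<in>J. s j)) I"
  using assms by (induction J rule: finite_induct) (auto intro!: has_sum_add)

lemma Riesz_hilbert:
  fixes \<phi> :: "'h::chilbert \<Rightarrow> complex"
  assumes "\<And>x y. \<phi> (x + y) = \<phi> x + \<phi> y" "\<And>c x. \<phi> (hscale c x) = c * \<phi> x"
    and "\<And>x. cmod (\<phi> x) \<le> C * H.nrm x"
  shows "\<exists>z. \<forall>x. \<phi> x = hinner x z"
proof -
  obtain B :: "'h set" where "orthonormal_basis B" using ex_orthonormal_basis by blast
  then interpret B: complete_orthonormal_family UNIV hscale hinner B "\<lambda>e. e"
    by (rule orthonormal_basis_complete_family)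
  show ?thesis
    by (rule B.Riesz_representation[OF assms]) auto
qed

text \<open>The description in \<open>hadj\<close> denotes something: Riesz supplies the vector and
  nondegeneracy its uniqueness.\<close>

lemma hadj_inner:
  fixes A :: "'h::chilbert \<Rightarrow> 'h"
  assumes "clinear A" "cbounded A"
  shows "hinner (A x) y = hinner x (hadj A y)"
proof -
  obtain C where C: "\<And>x. H.nrm (A x) \<le> C * H.nrm x"
    using assms(2) unfolding cbounded_def hnorm_eq by blast
  have bound: "cmod (hinner (A x) y) \<le> (C * H.nrm y) * H.nrm x" for x
  proof -
    have "cmod (hinner (A x) y) \<le> H.nrm (A x) * H.nrm y" by (rule H.Cauchy_Schwarz) auto
    also have "\<dots> \<le> (C * H.nrm x) * H.nrm y" by (intro mult_right_mono C) simp
    finally show ?thesis by (simp add: mult_ac)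
  qed
  obtain z where z: "\<And>x. hinner (A x) y = hinner x z"
    using Riesz_hilbert[of "\<lambda>x. hinner (A x) y", OF _ _ bound] assms(1)
    by (auto simp: clinear_def hinner_add_left hinner_hscale_left)
  have "hadj A y = z"
    unfolding hadj_def
  proof (rule the_equality)
    fix w assume "\<forall>x. hinner (A x) y = hinner x w"
    then show "w = z" using z by (intro hinner_eqI_right) simp
  qed (use z in blast)
  then show ?thesis using z by simp
qed

section \<open>Hilbert-Schmidt operators as square integrable functions\<close>

locale plancherel_rep = square_integrable_rep \<mu> m U
  for \<mu> :: "'a::{ab_group_add, t2_space} measure" and m
    and U :: "'a \<Rightarrow> 'h::chilbert \<Rightarrow> 'h" +
  assumes plancherel: "\<And>f. integrable \<mu> f \<Longrightarrow> integrable \<mu> (\<lambda>x. (cmod (f x))\<^sup>2) \<Longrightarrow>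
    (LINT \<xi>|\<mu>. (cmod (sfourier \<mu> m f \<xi>))\<^sup>2) = (LINT x|\<mu>. (cmod (f x))\<^sup>2)"
begin

lemma orthogonal_mc_AE_zero:
  assumes g: "g \<in> L2 \<mu>" and orth: "\<And>p q. l2_inner \<mu> g (mc p q) = 0"
  shows "AE x in \<mu>. g x = 0"
proof (rule AE_zero[OF g])
  fix p q
  have [measurable]: "g \<in> borel_measurable \<mu>" using g by (simp add: L2_def)
  define h where "h x = g x * hinner (U x p) q" for x
  have [measurable]: "h \<in> borel_measurable \<mu>" unfolding h_def by measurable
  \<comment> \<open>Plancherel is available for functions that are both integrable and square
    integrable: \<open>h\<close> is the former as a product of two square integrable functions, the
    latter because the coefficient is bounded.\<close>
  have h1: "integrable \<mu> h"
    unfolding h_def by (intro L2_mult_integrable g coeff_L2)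
  have h2: "integrable \<mu> (\<lambda>x. (cmod (h x))\<^sup>2)"
  proof (rule Bochner_Integration.integrable_bound)
    show "integrable \<mu> (\<lambda>x. (H.nrm p * H.nrm q)\<^sup>2 * (cmod (g x))\<^sup>2)"
      using L2_integrable[OF g] by simp
    show "AE x in \<mu>. norm ((cmod (h x))\<^sup>2) \<le> norm ((H.nrm p * H.nrm q)\<^sup>2 * (cmod (g x))\<^sup>2)"
    proof (rule AE_I2)
      fix x
      have "cmod (h x) \<le> (H.nrm p * H.nrm q) * cmod (g x)"
        using mult_right_mono[OF coeff_bound[of x p q], of "cmod (g x)"]
        by (simp add: h_def norm_mult mult.commute)
      then have "(cmod (h x))\<^sup>2 \<le> ((H.nrm p * H.nrm q) * cmod (g x))\<^sup>2" by (intro power_mono) auto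
      then show "norm ((cmod (h x))\<^sup>2) \<le> norm ((H.nrm p * H.nrm q)\<^sup>2 * (cmod (g x))\<^sup>2)"
        by (simp add: power_mult_distrib)
    qed
  qed measurable
  have "sfourier \<mu> m h \<xi> = 0" for \<xi>
  proof -
    have "sfourier \<mu> m h \<xi> = l2_inner \<mu> g (mc (U \<xi> p) (U \<xi> q))"
      by (simp add: sfourier_def h_def l2_inner_mc U_conjugation mult_ac)
    then show ?thesis by (simp add: orth)
  qed
  then have "(LINT x|\<mu>. (cmod (h x))\<^sup>2) = 0" using plancherel[OF h1 h2] by simp
  then have "AE x in \<mu>. (cmod (h x))\<^sup>2 = 0"
    using h2 by (subst (asm) integral_nonneg_eq_0_iff_AE) auto
  then show "AE x in \<mu>. g x * hinner (U x p) q = 0" by (simp add: h_def)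
qed

lemma mc_complete_family:
  assumes B: "orthonormal_basis B"
  shows "complete_orthonormal_family (L2 \<mu>) l2_scale (l2_inner \<mu>) (B \<times> B) (\<lambda>(e, f). mc e f)"
proof
  have "hinner e f = (if e = f then 1 else 0)" if "e \<in> B" "f \<in> B" for e f
    using B that by (simp add: orthonormal_basis_def)
  then show "l2_inner \<mu> (case i of (e, f) \<Rightarrow> mc e f) (case j of (e, f) \<Rightarrow> mc e f) = (if i = j then 1 else 0)"
    if "i \<in> B \<times> B" "j \<in> B \<times> B" for i j
    using that by (auto simp: l2_inner_mc_mc split: if_splits)
next
  fix g assume g: "g \<in> L2 \<mu>"
    and 0: "\<And>i. i \<in> B \<times> B \<Longrightarrow> l2_inner \<mu> g (case i of (e, f) \<Rightarrow> mc e f) = 0"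
  have "l2_inner \<mu> g (mc p q) = 0" for p q
    by (rule bounded_form_eq_0[OF B form_linear[OF g] form_bound[OF g]]) (use 0 in force)
  then show "L2.nrm \<mu> g = 0"
    using orthogonal_mc_AE_zero[OF g] by (simp add: L2_nrm_eq_0 g)
qed (auto simp: mc_L2)

text \<open>The weak form of \<open>A\<close> being the integral of \<open>g x\<close> times
  \<open>U x\<close>. It is a relation because \<open>A\<close> determines \<open>g\<close> only up
  to null sets.\<close>

definition represents :: "('a \<Rightarrow> complex) \<Rightarrow> ('h \<Rightarrow> 'h) \<Rightarrow> bool" where
  "represents g A \<longleftrightarrow> g \<in> L2 \<mu> \<and> (\<forall>p q. hinner (A p) q = l2_inner \<mu> g (mc p q))"

lemma represents_unique:
  assumes "represents g A" "represents g' A"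
  shows "AE x in \<mu>. g x = g' x"
proof -
  have L: "g \<in> L2 \<mu>" "g' \<in> L2 \<mu>" using assms by (auto simp: represents_def)
  have "AE x in \<mu>. (g - g') x = 0"
  proof (rule orthogonal_mc_AE_zero)
    show "l2_inner \<mu> (g - g') (mc p q) = 0" for p q
      using assms L by (simp add: represents_def L2.ip_diff_left mc_L2)
  qed (use L L2_diff in blast)
  then show ?thesis by simp
qed

text \<open>The coefficients of \<open>g\<close> in the family \<open>mc e f\<close> are the matrix
  entries of \<open>A\<close>, so this is Parseval's identity.\<close>

lemma represents_has_sum_pairs:
  assumes "represents g A" "orthonormal_basis B"
  shows "((\<lambda>(e, f). (cmod (hinner (A e) f))\<^sup>2) has_sum (LINT x|\<mu>. (cmod (g x))\<^sup>2)) (B \<times> B)"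
proof -
  interpret M: complete_orthonormal_family "L2 \<mu>" l2_scale "l2_inner \<mu>" "B \<times> B" "\<lambda>(e, f). mc e f"
    using assms(2) by (rule mc_complete_family)
  have "((\<lambda>i. (cmod (l2_inner \<mu> g (case i of (e, f) \<Rightarrow> mc e f)))\<^sup>2) has_sum (L2.nrm \<mu> g)\<^sup>2) (B \<times> B)"
    using assms(1) by (intro M.Parseval) (simp add: represents_def)
  moreover have "(\<lambda>i. (cmod (l2_inner \<mu> g (case i of (e, f) \<Rightarrow> mc e f)))\<^sup>2) =
      (\<lambda>(e, f). (cmod (hinner (A e) f))\<^sup>2)"
    using assms(1) by (auto simp: represents_def fun_eq_iff)
  ultimately show ?thesis by (simp add: L2_nrm_power2)
qed

lemma represents_has_sum:
  assumes "represents g A" "orthonormal_basis B"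
  shows "((\<lambda>e. (hnorm (A e))\<^sup>2) has_sum (LINT x|\<mu>. (cmod (g x))\<^sup>2)) B"
proof -
  interpret B: complete_orthonormal_family UNIV hscale hinner B "\<lambda>e. e"
    using assms(2) by (rule orthonormal_basis_complete_family)
  show ?thesis
    by (rule has_sum_SigmaD[OF represents_has_sum_pairs[OF assms]])
       (use B.Parseval in \<open>simp add: hnorm_eq\<close>)
qed

text \<open>The matrix entries of \<open>A\<close> are square summable, so Riesz-Fischer yields
  \<open>g\<close> with these coefficients; the two bounded forms agree on basis pairs and hence
  everywhere.\<close>

lemma ex_represents:
  assumes "hilbert_schmidt A"
  shows "\<exists>g. represents g A"
proof -
  obtain B where A: "clinear A" "cbounded A" and B: "orthonormal_basis B"
    and s: "(\<lambda>e. (H.nrm (A e))\<^sup>2) summable_on B"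
    using assms unfolding hilbert_schmidt_def hnorm_eq by blast
  interpret B: complete_orthonormal_family UNIV hscale hinner B "\<lambda>e. e"
    using B by (rule orthonormal_basis_complete_family)
  interpret M: complete_orthonormal_family "L2 \<mu>" l2_scale "l2_inner \<mu>" "B \<times> B" "\<lambda>(e, f). mc e f"
    using B by (rule mc_complete_family)
  obtain C where C: "\<And>x. H.nrm (A x) \<le> C * H.nrm x"
    using A(2) unfolding cbounded_def hnorm_eq by blast
  have "(\<lambda>i. (cmod (case i of (e, f) \<Rightarrow> hinner (A e) f))\<^sup>2) summable_on (B \<times> B)"
    by (rule summable_on_SigmaI[OF _ s]) (use B.Parseval in auto)
  then obtain g where g: "g \<in> L2 \<mu>"
    and coef: "\<And>i. i \<in> B \<times> B \<Longrightarrow> l2_inner \<mu> g (case i of (e, f) \<Rightarrow> mc e f) = (case i of (e, f) \<Rightarrow> hinner (A e) f)"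
    using M.Riesz_Fischer by metis
  have "hinner (A p) q - l2_inner \<mu> g (mc p q) = 0" for p q
  proof (rule bounded_form_eq_0[OF B, where C = "C + L2.nrm \<mu> g"])
    fix e f assume "e \<in> B" "f \<in> B"
    then show "hinner (A e) f - l2_inner \<mu> g (mc e f) = 0" using coef[of "(e, f)"] by simp
  next
    fix p q
    have "cmod (hinner (A p) q) \<le> H.nrm (A p) * H.nrm q" by (rule H.Cauchy_Schwarz) auto
    also have "\<dots> \<le> C * H.nrm p * H.nrm q" by (intro mult_right_mono C) simp
    finally have "cmod (hinner (A p) q) \<le> C * H.nrm p * H.nrm q" .
    then show "cmod (hinner (A p) q - l2_inner \<mu> g (mc p q)) \<le> (C + L2.nrm \<mu> g) * H.nrm p * H.nrm q"
      using form_bound[OF g, of p q] norm_triangle_ineq4[of "hinner (A p) q" "l2_inner \<mu> g (mc p q)"]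
      by (simp add: algebra_simps)
  qed (use A(1) g in \<open>simp_all add: clinear_def form_linear hinner_add_left hinner_hscale_left
      H.ip_add_right H.ip_scl_right algebra_simps\<close>)
  then show ?thesis using g by (auto simp: represents_def)
qed

text \<open>The definition supplies a single basis; the representing function transfers summability
  to every other one.\<close>

lemma hilbert_schmidt_summable:
  fixes A :: "'h \<Rightarrow> 'h"
  assumes "hilbert_schmidt A" "orthonormal_basis B"
  shows "(\<lambda>e. (hnorm (A e))\<^sup>2) summable_on B"
proof -
  obtain g where "represents g A" using ex_represents[OF assms(1)] by blast
  then show ?thesis using represents_has_sum assms(2) summable_on_def by blast
qed

text \<open>The form defined by \<open>g\<close> is bounded, so Riesz gives an operator, first
  vector by vector. Testing the form on \<open>A p\<close> bounds it, and Parseval makes it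
  Hilbert-Schmidt.\<close>

lemma ex_represented_operator:
  assumes g: "g \<in> L2 \<mu>"
  shows "\<exists>A. hilbert_schmidt A \<and> represents g A"
proof -
  obtain B :: "'h set" where B: "orthonormal_basis B" using ex_orthonormal_basis by blast
  have "\<exists>z. \<forall>q. hinner z q = l2_inner \<mu> g (mc p q)" for p
  proof -
    have bound: "cmod (cnj (l2_inner \<mu> g (mc p q))) \<le> (L2.nrm \<mu> g * H.nrm p) * H.nrm q" for q
      using form_bound[OF g, of p q] by simp
    have "\<exists>z. \<forall>q. cnj (l2_inner \<mu> g (mc p q)) = hinner q z"
      by (rule Riesz_hilbert[OF _ _ bound]) (simp_all add: form_linear[OF g])
    then obtain z where z: "\<And>q. cnj (l2_inner \<mu> g (mc p q)) = hinner q z" by blast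
    have "hinner z q = l2_inner \<mu> g (mc p q)" for q
      using z[of q] hinner_cnj[of z q] by (metis complex_cnj_cnj)
    then show ?thesis by blast
  qed
  then obtain A where A: "\<And>p q. hinner (A p) q = l2_inner \<mu> g (mc p q)" by metis
  have rep: "represents g A" using g A by (simp add: represents_def)
  have "clinear A"
    unfolding clinear_def
    by (intro conjI allI; rule hinner_eqI; simp add: A form_linear[OF g] hinner_add_left hinner_hscale_left)
  moreover have "cbounded A"
    unfolding cbounded_def hnorm_eq
  proof (intro exI allI)
    fix p
    have "(H.nrm (A p))\<^sup>2 \<le> cmod (hinner (A p) (A p))"
      by (simp add: H.ip_self norm_power)
    also have "\<dots> \<le> (L2.nrm \<mu> g * H.nrm p) * H.nrm (A p)"
      using form_bound[OF g, of p "A p"] by (simp add: A)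
    finally have "H.nrm (A p) * H.nrm (A p) \<le> (L2.nrm \<mu> g * H.nrm p) * H.nrm (A p)"
      by (simp add: power2_eq_square)
    then show "H.nrm (A p) \<le> L2.nrm \<mu> g * H.nrm p"
    proof (cases "H.nrm (A p) = 0")
      case False
      then have "H.nrm (A p) > 0" using H.nrm_nonneg[OF UNIV_I, of "A p"] by linarith
      then show ?thesis using \<open>H.nrm (A p) * H.nrm (A p) \<le> _\<close> by simp
    qed (simp add: g)
  qed
  ultimately have "hilbert_schmidt A"
    using represents_has_sum[OF rep B] B unfolding hilbert_schmidt_def summable_on_def by blast
  then show ?thesis using rep by blast
qed

section \<open>Products of Hilbert-Schmidt operators and their traces\<close>

lemma hilbert_schmidt_comp:
  fixes P Q :: "'h \<Rightarrow> 'h"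
  assumes P: "hilbert_schmidt P" and Q: "hilbert_schmidt Q"
  shows "hilbert_schmidt (P \<circ> Q)"
proof -
  obtain C where C: "\<And>x. H.nrm (P x) \<le> C * H.nrm x"
    using P unfolding hilbert_schmidt_def cbounded_def hnorm_eq by blast
  have C': "H.nrm (P x) \<le> \<bar>C\<bar> * H.nrm x" for x
    using C[of x] mult_right_mono[OF abs_ge_self[of C], of "H.nrm x"] by simp
  obtain D where D: "\<And>x. H.nrm (Q x) \<le> D * H.nrm x"
    using Q unfolding hilbert_schmidt_def cbounded_def hnorm_eq by blast
  obtain B where B: "orthonormal_basis B" "(\<lambda>e. (H.nrm (Q e))\<^sup>2) summable_on B"
    using Q unfolding hilbert_schmidt_def hnorm_eq by blast
  have "clinear (P \<circ> Q)"
    using P Q by (simp add: hilbert_schmidt_def clinear_def)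
  moreover have "cbounded (P \<circ> Q)"
    unfolding cbounded_def hnorm_eq
  proof (intro exI allI)
    fix x
    have "H.nrm (P (Q x)) \<le> \<bar>C\<bar> * H.nrm (Q x)" by (rule C')
    also have "\<dots> \<le> \<bar>C\<bar> * (D * H.nrm x)" by (intro mult_left_mono D) simp
    finally show "H.nrm ((P \<circ> Q) x) \<le> (\<bar>C\<bar> * D) * H.nrm x" by (simp add: mult.assoc)
  qed
  moreover have "(\<lambda>e. (H.nrm ((P \<circ> Q) e))\<^sup>2) summable_on B"
  proof (rule summable_on_comparison_test)
    show "(\<lambda>e. C\<^sup>2 * (H.nrm (Q e))\<^sup>2) summable_on B"
      using B(2) by (rule summable_on_cmult_right)
    show "(H.nrm ((P \<circ> Q) e))\<^sup>2 \<le> C\<^sup>2 * (H.nrm (Q e))\<^sup>2" for e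
      using power_mono[OF C'[of "Q e"], of 2] by (simp add: power_mult_distrib)
  qed simp
  ultimately show ?thesis using B(1) unfolding hilbert_schmidt_def hnorm_eq by blast
qed

lemma hadj_U: "hinner (U \<xi> x) y = hinner x (hadj (U \<xi>) y)"
proof (rule hadj_inner)
  show "clinear (U \<xi>)" using U_unitary by (simp add: unitary_op_def)
  show "cbounded (U \<xi>)" unfolding cbounded_def hnorm_eq by (intro exI[of _ 1]) simp
qed

text \<open>Up to conjugation the matrix of the adjoint is the transpose, so swapping the two
  summations gives the same total.\<close>

lemma hadj_has_sum:
  fixes Q :: "'h \<Rightarrow> 'h"
  assumes Q: "clinear Q" "cbounded Q" "represents g Q" and B: "orthonormal_basis B"
  shows "((\<lambda>f. (H.nrm (hadj Q f))\<^sup>2) has_sum (LINT x|\<mu>. (cmod (g x))\<^sup>2)) B"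
proof -
  interpret B: complete_orthonormal_family UNIV hscale hinner B "\<lambda>e. e"
    using B by (rule orthonormal_basis_complete_family)
  have "((\<lambda>(f, e). (cmod (hinner (Q e) f))\<^sup>2) has_sum (LINT x|\<mu>. (cmod (g x))\<^sup>2)) (B \<times> B)"
    using represents_has_sum_pairs[OF Q(3) B] by (subst (asm) has_sum_swap) simp
  then show ?thesis
  proof (rule has_sum_SigmaD)
    fix f
    have "cmod (hinner (Q e) f) = cmod (hinner (hadj Q f) e)" for e
      using hadj_inner[OF Q(1,2), of e f] hinner_cnj[of "hadj Q f" e] by simp
    then show "((\<lambda>e. case (f, e) of (f, e) \<Rightarrow> (cmod (hinner (Q e) f))\<^sup>2) has_sum (H.nrm (hadj Q f))\<^sup>2) B"
      using B.Parseval[of "hadj Q f"] by simp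
  qed
qed

text \<open>The trace as a sum over the \<^emph>\<open>intermediate\<close> index: unlike the defining sum over
  \<open>\<langle>P Q U\<^sub>\<xi>\<^sup>* e, e\<rangle>\<close>, it is dominated by a summable family not depending on \<open>\<xi>\<close>.\<close>
lemma fourier_U_has_sum:
  fixes P Q :: "'h \<Rightarrow> 'h"
  assumes P: "hilbert_schmidt P" and Q: "hilbert_schmidt Q"
  defines "B \<equiv> (SOME B :: 'h set. orthonormal_basis B)"
  shows "((\<lambda>f. mc (hadj Q f) (P f) \<xi>) has_sum fourier_U U (P \<circ> Q) \<xi>) B"
proof -
  have B: "orthonormal_basis B"
    unfolding B_def using ex_orthonormal_basis by (rule someI_ex)
  interpret B: complete_orthonormal_family UNIV hscale hinner B "\<lambda>e. e"
    using B by (rule orthonormal_basis_complete_family)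
  have P': "clinear P" "cbounded P" and Q': "clinear Q" "cbounded Q"
    using P Q by (auto simp: hilbert_schmidt_def)
  obtain q where q: "represents q Q" using ex_represents[OF Q] by blast
  have U': "hinner (hadj (U \<xi>) x) y = hinner x (U \<xi> y)" for x y
    using hadj_U[of \<xi> y x] hinner_cnj[of "hadj (U \<xi>) x" y] hinner_cnj[of x "U \<xi> y"]
    by (metis complex_cnj_cnj)
  \<comment> \<open>Summing over \<open>e\<close> first gives the terms of the claimed series,
    summing over \<open>f\<close> first the diagonal entries defining the trace; absolute
    summability makes both totals equal.\<close>
  define a where "a f e = hinner (P f) e * hinner e (U \<xi> (hadj Q f))" for f e
  have a: "a f e = hinner (Q (hadj (U \<xi>) e)) f * hinner f (hadj P e)" for f e
    unfolding a_def using hadj_inner[OF Q', of "hadj (U \<xi>) e" f] hadj_inner[OF P', of f e] U'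
    by (simp add: mult.commute)
  \<comment> \<open>A majorant for the products: by Parseval and unitarity of \<open>U \<xi>\<close>
    its row sums do not involve \<xi>.\<close>
  have "(\<lambda>(f, e). (cmod (hinner (P f) e))\<^sup>2 + (cmod (hinner (U \<xi> (hadj Q f)) e))\<^sup>2) summable_on (B \<times> B)"
  proof (rule summable_on_SigmaI)
    show "(\<lambda>f. (H.nrm (P f))\<^sup>2 + (H.nrm (hadj Q f))\<^sup>2) summable_on B"
      using hilbert_schmidt_summable[OF P B] hadj_has_sum[OF Q' q B]
      by (intro summable_on_add) (auto simp: hnorm_eq summable_on_def)
    show "((\<lambda>e. case (f, e) of (f, e) \<Rightarrow> (cmod (hinner (P f) e))\<^sup>2 + (cmod (hinner (U \<xi> (hadj Q f)) e))\<^sup>2)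
        has_sum (H.nrm (P f))\<^sup>2 + (H.nrm (hadj Q f))\<^sup>2) B" for f
      using has_sum_add[OF B.Parseval[of "P f"] B.Parseval[of "U \<xi> (hadj Q f)"]] by simp
  qed auto
  then have "(\<lambda>x. norm (case x of (f, e) \<Rightarrow> a f e)) summable_on (B \<times> B)"
  proof (rule summable_on_comparison_test)
    fix x assume "x \<in> B \<times> B"
    obtain f e where x: "x = (f, e)" by (cases x)
    let ?u = "cmod (hinner (P f) e)" and ?v = "cmod (hinner (U \<xi> (hadj Q f)) e)"
    have "0 \<le> (?u - ?v)\<^sup>2" "0 \<le> ?u * ?v" by auto
    then have "?u * ?v \<le> ?u\<^sup>2 + ?v\<^sup>2" unfolding power2_diff by linarith
    moreover have "cmod (hinner e (U \<xi> (hadj Q f))) = ?v"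
      using hinner_cnj[of "U \<xi> (hadj Q f)" e] by simp
    ultimately show "norm (case x of (f, e) \<Rightarrow> a f e) \<le>
        (case x of (f, e) \<Rightarrow> (cmod (hinner (P f) e))\<^sup>2 + (cmod (hinner (U \<xi> (hadj Q f)) e))\<^sup>2)"
      by (simp add: x a_def norm_mult)
  qed simp
  then have "(\<lambda>(f, e). a f e) summable_on (B \<times> B)"
    by (rule abs_summable_summable)
  then obtain s where s: "((\<lambda>(f, e). a f e) has_sum s) (B \<times> B)"
    unfolding summable_on_def by blast
  have "((\<lambda>f. hinner (P f) (U \<xi> (hadj Q f))) has_sum s) B"
    by (rule has_sum_SigmaD[OF s]) (use B.ip_has_sum in \<open>simp add: a_def\<close>)
  moreover have "mc (hadj Q f) (P f) \<xi> = hinner (P f) (U \<xi> (hadj Q f))" for f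
    unfolding mc_def by (rule hinner_cnj[symmetric])
  moreover have "((\<lambda>e. hinner ((P \<circ> Q \<circ> hadj (U \<xi>)) e) e) has_sum s) B"
  proof (rule has_sum_SigmaD)
    show "((\<lambda>(e, f). a f e) has_sum s) (B \<times> B)"
      using s by (subst (asm) has_sum_swap) simp
    show "((\<lambda>f. case (e, f) of (e, f) \<Rightarrow> a f e) has_sum hinner ((P \<circ> Q \<circ> hadj (U \<xi>)) e) e) B" for e
      using B.ip_has_sum[of "Q (hadj (U \<xi>) e)" "hadj P e"] by (simp add: a hadj_inner[OF P'])
  qed
  then have "fourier_U U (P \<circ> Q) \<xi> = s"
    unfolding fourier_U_def op_trace_def B_def[symmetric] by (rule infsumI)
  ultimately show ?thesis by simp
qed

text \<open>By the orthogonality relations \<open>mc (hadj Q f) (P f)\<close> represents the rank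
  one operator sending \<open>p\<close> to \<open>hscale (hinner (Q p) f) (P f)\<close>.\<close>

lemma represents_truncation:
  fixes P Q :: "'h \<Rightarrow> 'h"
  assumes Q: "clinear Q" "cbounded Q" and g: "represents g (P \<circ> Q)"
  shows "represents (g - (\<Sum>f\<in>F. mc (hadj Q f) (P f)))
    (\<lambda>p. P (Q p) - (\<Sum>f\<in>F. hscale (hinner (Q p) f) (P f)))"
proof -
  have S: "(\<Sum>f\<in>F. mc (hadj Q f) (P f)) \<in> L2 \<mu>" by (intro L2.sum_mem mc_L2)
  show ?thesis
    unfolding represents_def
  proof (intro conjI allI)
    fix p r
    have "hinner (\<Sum>f\<in>F. hscale (hinner (Q p) f) (P f)) r = (\<Sum>f\<in>F. hinner (Q p) f * hinner (P f) r)"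
      by (subst H.ip_sum_left) (auto simp: hinner_hscale_left)
    moreover have "l2_inner \<mu> (\<Sum>f\<in>F. mc (hadj Q f) (P f)) (mc p r) = (\<Sum>f\<in>F. hinner (Q p) f * hinner (P f) r)"
      by (subst L2.ip_sum_left) (auto simp: mc_L2 l2_inner_mc_mc hadj_inner[OF Q])
    ultimately show "hinner (P (Q p) - (\<Sum>f\<in>F. hscale (hinner (Q p) f) (P f))) r =
        l2_inner \<mu> (g - (\<Sum>f\<in>F. mc (hadj Q f) (P f))) (mc p r)"
      using g S by (simp add: represents_def H.ip_diff_left L2.ip_diff_left mc_L2)
  qed (use g S L2_diff in \<open>auto simp: represents_def\<close>)
qed

text \<open>The truncated operator is \<open>P\<close> applied to the residual of \<open>Q e\<close>
  after expansion along \<open>F\<close>. Its squared norm is bounded by the residual formula, and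
  summing over \<open>e\<close> turns the entries for each \<open>f\<close> into the squared norm of
  \<open>hadj Q f\<close>.\<close>

lemma truncation_bound:
  fixes P Q :: "'h \<Rightarrow> 'h"
  assumes P: "clinear P" "\<And>x. H.nrm (P x) \<le> C * H.nrm x"
    and Q: "clinear Q" "cbounded Q" "represents q Q" and g: "represents g (P \<circ> Q)"
    and B: "orthonormal_basis B" and F: "finite F" "F \<subseteq> B"
  shows "(LINT x|\<mu>. (cmod ((g - (\<Sum>f\<in>F. mc (hadj Q f) (P f))) x))\<^sup>2) \<le>
    C\<^sup>2 * ((LINT x|\<mu>. (cmod (q x))\<^sup>2) - (\<Sum>f\<in>F. (H.nrm (hadj Q f))\<^sup>2))"
proof -
  interpret B: complete_orthonormal_family UNIV hscale hinner B "\<lambda>e. e"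
    using B by (rule orthonormal_basis_complete_family)
  let ?D = "\<lambda>e. P (Q e) - (\<Sum>f\<in>F. hscale (hinner (Q e) f) (P f))"
  have P0: "P 0 = 0" using P(1) hscale_zero_left unfolding clinear_def by metis
  have Psum: "P (sum h F) = (\<Sum>f\<in>F. P (h f))" for h :: "'h \<Rightarrow> 'h"
    using P(1) P0 by (induction F rule: infinite_finite_induct) (auto simp: clinear_def)
  have Pdiff: "P (x - y) = P x - P y" for x y
  proof -
    have "P (x - y + y) = P (x - y) + P y" using P(1) unfolding clinear_def by blast
    then show ?thesis by (simp add: algebra_simps)
  qed
  have adj: "cmod (hinner (Q e) f) = cmod (hinner (hadj Q f) e)" for e f
    using hadj_inner[OF Q(1,2), of e f] hinner_cnj[of "hadj Q f" e] by simp
  have D: "(hnorm (?D e))\<^sup>2 \<le> C\<^sup>2 * ((hnorm (Q e))\<^sup>2 - (\<Sum>f\<in>F. (cmod (hinner (hadj Q f) e))\<^sup>2))" for e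
  proof -
    have "?D e = P (Q e - B.lincomb (\<lambda>f. hinner (Q e) f) F)"
      using P(1) by (simp add: B.lincomb_def Pdiff Psum clinear_def)
    then have "(H.nrm (?D e))\<^sup>2 \<le> (C * H.nrm (Q e - B.lincomb (\<lambda>f. hinner (Q e) f) F))\<^sup>2"
      using P(2) by (simp add: power_mono)
    also have "\<dots> = C\<^sup>2 * ((H.nrm (Q e))\<^sup>2 - (\<Sum>f\<in>F. (cmod (hinner (Q e) f))\<^sup>2))"
      using B.nrm_diff_lincomb[OF F, of "Q e"] by (simp add: power_mult_distrib)
    finally show ?thesis by (simp add: hnorm_eq adj)
  qed
  show ?thesis
  proof (rule has_sum_mono[OF _ _ D])
    show "((\<lambda>e. (hnorm (?D e))\<^sup>2) has_sum (LINT x|\<mu>. (cmod ((g - (\<Sum>f\<in>F. mc (hadj Q f) (P f))) x))\<^sup>2)) B"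
      by (rule represents_has_sum[OF represents_truncation[OF Q(1,2) g] B])
    have "((\<lambda>e. (hnorm (Q e))\<^sup>2) has_sum (LINT x|\<mu>. (cmod (q x))\<^sup>2)) B"
      by (rule represents_has_sum[OF Q(3) B])
    moreover have "((\<lambda>e. - (\<Sum>f\<in>F. (cmod (hinner (hadj Q f) e))\<^sup>2)) has_sum - (\<Sum>f\<in>F. (H.nrm (hadj Q f))\<^sup>2)) B"
      unfolding has_sum_uminus minus_minus using B.Parseval by (intro has_sum_sum_finite F) simp
    ultimately show "((\<lambda>e. C\<^sup>2 * ((hnorm (Q e))\<^sup>2 - (\<Sum>f\<in>F. (cmod (hinner (hadj Q f) e))\<^sup>2))) has_sum
        C\<^sup>2 * ((LINT x|\<mu>. (cmod (q x))\<^sup>2) - (\<Sum>f\<in>F. (H.nrm (hadj Q f))\<^sup>2))) B"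
      using has_sum_cmult_right[OF has_sum_add] by fastforce
  qed
qed

text \<open>The partial sums \<open>T n\<close> tend to the trace function pointwise and to
  \<open>g\<close> in square mean; Fatou forces the two limits to agree almost everywhere.\<close>

lemma trace_class_represents_AE:
  fixes P Q :: "'h \<Rightarrow> 'h"
  assumes P: "hilbert_schmidt P" and Q: "hilbert_schmidt Q" and g: "represents g (P \<circ> Q)"
  shows "AE \<xi> in \<mu>. g \<xi> = fourier_U U (P \<circ> Q) \<xi>"
proof -
  define B where "B = (SOME B :: 'h set. orthonormal_basis B)"
  have B: "orthonormal_basis B"
    unfolding B_def using ex_orthonormal_basis by (rule someI_ex)
  have P': "clinear P" "cbounded P" and Q': "clinear Q" "cbounded Q"
    using P Q by (auto simp: hilbert_schmidt_def)
  obtain q where q: "represents q Q" using ex_represents[OF Q] by blast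
  obtain C where C: "\<And>x. H.nrm (P x) \<le> C * H.nrm x"
    using P'(2) unfolding cbounded_def hnorm_eq by blast
  define t where "t = fourier_U U (P \<circ> Q)"
  \<comment> \<open>This majorant dominates both the terms of the trace series and the squared norms
    in \<open>truncation_bound\<close>, so one choice of \<open>F n\<close> serves both
    limits.\<close>
  define a where "a f = (H.nrm (P f))\<^sup>2 + (H.nrm (hadj Q f))\<^sup>2" for f
  have "a summable_on B"
    unfolding a_def using hilbert_schmidt_summable[OF P B] hadj_has_sum[OF Q' q B]
    by (intro summable_on_add) (auto simp: hnorm_eq summable_on_def)
  then have "\<exists>F. finite F \<and> F \<subseteq> B \<and> (\<forall>G. finite G \<longrightarrow> G \<subseteq> B \<longrightarrow> G \<inter> F = {} \<longrightarrow> sum a G < inverse (Suc n))" for n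
    by (rule summable_on_tail_less[of a B "inverse (Suc n)"]) (auto simp: a_def)
  then obtain F where F: "\<And>n. finite (F n)" "\<And>n. F n \<subseteq> B"
    and tail: "\<And>n G. finite G \<Longrightarrow> G \<subseteq> B \<Longrightarrow> G \<inter> F n = {} \<Longrightarrow> sum a G < inverse (Suc n)"
    by metis
  define T where "T n = (\<Sum>f\<in>F n. mc (hadj Q f) (P f))" for n
  have T_apply: "T n \<xi> = (\<Sum>f\<in>F n. mc (hadj Q f) (P f) \<xi>)" for n \<xi>
    unfolding T_def by (rule sum_fun_apply)
  have T: "T n \<in> L2 \<mu>" for n unfolding T_def by (intro L2.sum_mem mc_L2)
  have inv0: "(\<lambda>n. inverse (real (Suc n))) \<longlonglongrightarrow> 0" by (rule LIMSEQ_inverse_real_of_nat)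
  have lim: "(\<lambda>n. T n \<xi>) \<longlonglongrightarrow> t \<xi>" for \<xi>
  proof -
    have "norm (t \<xi> - T n \<xi>) \<le> inverse (real (Suc n))" for n
      unfolding T_apply t_def
    proof (rule has_sum_tail_bound[OF fourier_U_has_sum[OF P Q, folded B_def] F(1,2) _ tail])
      fix f
      have "norm (mc (hadj Q f) (P f) \<xi>) \<le> H.nrm (hadj Q f) * H.nrm (P f)"
        using coeff_bound[of \<xi> "hadj Q f" "P f"] by (simp add: mc_def)
      also have "\<dots> \<le> a f"
      proof -
        have "0 \<le> (H.nrm (hadj Q f) - H.nrm (P f))\<^sup>2" "0 \<le> H.nrm (hadj Q f) * H.nrm (P f)" by auto
        then show ?thesis unfolding power2_diff a_def by linarith
      qed
      finally show "norm (mc (hadj Q f) (P f) \<xi>) \<le> a f" .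
    qed
    then have "(\<lambda>n. t \<xi> - T n \<xi>) \<longlonglongrightarrow> 0"
      by (intro Lim_null_comparison[OF _ inv0] always_eventually) auto
    then have "(\<lambda>n. t \<xi> - (t \<xi> - T n \<xi>)) \<longlonglongrightarrow> t \<xi> - 0" by (intro tendsto_intros)
    then show ?thesis by simp
  qed
  have gL: "g \<in> L2 \<mu>" using g by (simp add: represents_def)
  have [measurable]: "g \<in> borel_measurable \<mu>" "\<And>n. T n \<in> borel_measurable \<mu>"
    using gL T by (auto simp: L2_def)
  have [measurable]: "t \<in> borel_measurable \<mu>"
    by (rule borel_measurable_LIMSEQ_metric[of T]) (auto intro: lim)
  have small: "(LINT x|\<mu>. (cmod ((g - T n) x))\<^sup>2) \<le> C\<^sup>2 * inverse (real (Suc n))" for n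
  proof -
    have "norm ((LINT x|\<mu>. (cmod (q x))\<^sup>2) - (\<Sum>f\<in>F n. (H.nrm (hadj Q f))\<^sup>2)) \<le> inverse (real (Suc n))"
      by (rule has_sum_tail_bound[OF hadj_has_sum[OF Q' q B] F(1,2) _ tail]) (simp add: a_def)
    then have "(LINT x|\<mu>. (cmod (q x))\<^sup>2) - (\<Sum>f\<in>F n. (H.nrm (hadj Q f))\<^sup>2) \<le> inverse (real (Suc n))"
      unfolding real_norm_def by linarith
    then have "C\<^sup>2 * ((LINT x|\<mu>. (cmod (q x))\<^sup>2) - (\<Sum>f\<in>F n. (H.nrm (hadj Q f))\<^sup>2)) \<le>
        C\<^sup>2 * inverse (real (Suc n))"
      by (intro mult_left_mono) auto
    with truncation_bound[OF P'(1) C Q' q g B F(1,2)] show ?thesis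
      unfolding T_def by (rule order_trans)
  qed
  have d: "g - t \<in> L2 \<mu> \<and> (LINT x|\<mu>. (cmod ((g - t) x))\<^sup>2) \<le> \<epsilon>" if "\<epsilon> > 0" for \<epsilon>
  proof -
    have "(\<lambda>n. C\<^sup>2 * inverse (real (Suc n))) \<longlonglongrightarrow> C\<^sup>2 * 0" by (intro tendsto_intros inv0)
    then have "\<forall>\<^sub>F n in sequentially. C\<^sup>2 * inverse (real (Suc n)) < \<epsilon>"
      using that by (intro order_tendstoD(2)[where y = "C\<^sup>2 * 0"]) auto
    then have "\<forall>\<^sub>F n in sequentially. (LINT x|\<mu>. (cmod ((g - T n) x))\<^sup>2) \<le> \<epsilon>"
      by eventually_elim (use small in \<open>meson less_imp_le order_trans\<close>)
    moreover have "AE x in \<mu>. (\<lambda>n. (g - T n) x) \<longlonglongrightarrow> (g - t) x"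
      by (rule AE_I2) (auto intro!: tendsto_intros lim)
    moreover have "g - t \<in> borel_measurable \<mu>" by (simp add: fun_diff_def)
    ultimately show ?thesis
      using L2_Fatou[of "\<lambda>n. g - T n" \<mu> "g - t" \<epsilon>] L2_diff[OF gL T] by blast
  qed
  have "(LINT x|\<mu>. (cmod ((g - t) x))\<^sup>2) \<le> 0"
    by (rule field_le_epsilon) (use d in simp)
  then have "(L2.nrm \<mu> (g - t))\<^sup>2 \<le> 0" by (simp only: L2_nrm_power2)
  then have "L2.nrm \<mu> (g - t) = 0" by simp
  then have "AE x in \<mu>. (g - t) x = 0"
    using d[of 1] by (simp add: L2_nrm_eq_0)
  then show ?thesis by (simp add: t_def)
qed

end

section \<open>The unitary extension and its inverse\<close>

theorem theorem6p23:
  fixes \<mu> \<nu> :: "'a::{ab_group_add, t2_space} measure"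
    and m :: "'a \<Rightarrow> 'a \<Rightarrow> complex"
    and U :: "'a \<Rightarrow> 'h::chilbert \<Rightarrow> 'h"
  assumes "lca_group TYPE('a)"
    and "haar_measure \<mu>"
    and "multiplier m"
    and "heisenberg m"
    and "proj_rep_sq \<mu> m U"
    and "haar_normalized \<mu> U"
    and "dual_haar \<mu> m \<nu>"
    and "integrable_rep \<mu> U"
  shows "\<exists>V :: ('h \<Rightarrow> 'h) \<Rightarrow> 'a \<Rightarrow> complex.
     (\<forall>A. hilbert_schmidt A \<longrightarrow> V A \<in> borel_measurable \<nu> \<and> integrable \<nu> (\<lambda>\<xi>. (cmod (V A \<xi>))^2))
   \<and> (\<forall>A. trace_class A \<longrightarrow> (AE \<xi> in \<nu>. V A \<xi> = fourier_U U A \<xi>))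
   \<and> (\<forall>A B. hilbert_schmidt A \<and> hilbert_schmidt B \<longrightarrow>
        (AE \<xi> in \<nu>. V (\<lambda>\<phi>. A \<phi> + B \<phi>) \<xi> = V A \<xi> + V B \<xi>))
   \<and> (\<forall>A c. hilbert_schmidt A \<longrightarrow> (AE \<xi> in \<nu>. V (\<lambda>\<phi>. hscale c (A \<phi>)) \<xi> = c * V A \<xi>))
   \<and> (\<forall>A Bs. hilbert_schmidt A \<and> orthonormal_basis Bs \<longrightarrow>
        ((\<lambda>e. (hnorm (A e))^2) has_sum (LINT \<xi>|\<nu>. (cmod (V A \<xi>))^2)) Bs)
   \<and> (\<forall>g. g \<in> borel_measurable \<nu> \<and> integrable \<nu> (\<lambda>\<xi>. (cmod (g \<xi>))^2) \<longrightarrow>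
        (\<exists>A. hilbert_schmidt A \<and> (AE \<xi> in \<nu>. V A \<xi> = g \<xi>)))
   \<and> (\<forall>f. integrable \<nu> f \<and> integrable \<nu> (\<lambda>\<xi>. (cmod (f \<xi>))^2) \<longrightarrow>
        hilbert_schmidt (fourier_U_inv \<nu> U f) \<and> (AE \<xi> in \<nu>. V (fourier_U_inv \<nu> U f) \<xi> = f \<xi>))"
proof -
  interpret square_integrable_rep \<mu> m U
    using assms by unfold_locales
  have \<nu>: "\<nu> = \<mu>" using assms(7) by (rule dual_haar_eq)
  interpret plancherel_rep \<mu> m U
    using assms(7) by unfold_locales (simp add: dual_haar_def \<nu>)
  \<comment> \<open>Any representing function will do, as two of them differ on a null set only;
    linearity of \<open>V\<close> therefore holds almost everywhere.\<close>
  define V where "V A = (SOME g. represents g A)" for A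
  have V: "represents (V A) A" if "represents g A" for g A
    unfolding V_def using that by (rule someI[of "\<lambda>g. represents g A"])
  have V_HS: "represents (V A) A" if "hilbert_schmidt A" for A
    using ex_represents[OF that] V by blast
  have V_eq: "AE \<xi> in \<mu>. V A \<xi> = g \<xi>" if "represents g A" for g A
    using represents_unique[OF V[OF that] that] .
  have L: "V A \<in> L2 \<mu>" if "hilbert_schmidt A" for A
    using V_HS[OF that] by (simp add: represents_def)
  show ?thesis
    unfolding \<nu>
  proof (intro exI[of _ V] conjI allI impI; (elim conjE)?)
    fix A :: "'h \<Rightarrow> 'h" assume A: "hilbert_schmidt A"
    show "V A \<in> borel_measurable \<mu>" "integrable \<mu> (\<lambda>\<xi>. (cmod (V A \<xi>))\<^sup>2)"
      using L[OF A] by (auto simp: L2_def)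
  next
    fix A :: "'h \<Rightarrow> 'h" assume "trace_class A"
    then obtain P Q where PQ: "hilbert_schmidt P" "hilbert_schmidt Q" "A = P \<circ> Q"
      unfolding trace_class_def by blast
    show "AE \<xi> in \<mu>. V A \<xi> = fourier_U U A \<xi>"
      unfolding PQ(3) using PQ by (intro trace_class_represents_AE V_HS hilbert_schmidt_comp)
  next
    fix A B :: "'h \<Rightarrow> 'h" assume "hilbert_schmidt A" "hilbert_schmidt B"
    then have "represents (V A + V B) (\<lambda>\<phi>. A \<phi> + B \<phi>)"
      using V_HS[of A] V_HS[of B]
      by (simp add: represents_def L2_add L2.ip_add_left mc_L2 hinner_add_left)
    from V_eq[OF this] show "AE \<xi> in \<mu>. V (\<lambda>\<phi>. A \<phi> + B \<phi>) \<xi> = V A \<xi> + V B \<xi>" by simp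
  next
    fix A :: "'h \<Rightarrow> 'h" and c assume "hilbert_schmidt A"
    then have "represents (l2_scale c (V A)) (\<lambda>\<phi>. hscale c (A \<phi>))"
      using V_HS[of A] by (simp add: represents_def L2_scale L2.ip_scl_left mc_L2 hinner_hscale_left)
    from V_eq[OF this] show "AE \<xi> in \<mu>. V (\<lambda>\<phi>. hscale c (A \<phi>)) \<xi> = c * V A \<xi>"
      by (simp add: l2_scale_def)
  next
    fix A :: "'h \<Rightarrow> 'h" and Bs :: "'h set" assume "hilbert_schmidt A" "orthonormal_basis Bs"
    then show "((\<lambda>e. (hnorm (A e))\<^sup>2) has_sum (LINT \<xi>|\<mu>. (cmod (V A \<xi>))\<^sup>2)) Bs"
      by (intro represents_has_sum V_HS)
  next
    fix g assume "g \<in> borel_measurable \<mu>" "integrable \<mu> (\<lambda>\<xi>. (cmod (g \<xi>))\<^sup>2)"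
    then have "g \<in> L2 \<mu>" by (simp add: L2_def)
    then show "\<exists>A. hilbert_schmidt A \<and> (AE \<xi> in \<mu>. V A \<xi> = g \<xi>)"
      using ex_represented_operator V_eq by blast
  next
    fix f assume "integrable \<mu> f" "integrable \<mu> (\<lambda>\<xi>. (cmod (f \<xi>))\<^sup>2)"
    then have "f \<in> L2 \<mu>" by (auto simp: L2_def)
    then obtain A where A: "hilbert_schmidt A" "represents f A"
      using ex_represented_operator by blast
    \<comment> \<open>The weak integral in \<open>fourier_U_inv\<close> is the form represented by
      \<open>f\<close>, and nondegeneracy makes its description unique.\<close>
    have "fourier_U_inv \<mu> U f = A"
    proof
      fix p
      have *: "hinner (A p) r = (LINT \<xi>|\<mu>. f \<xi> * hinner (U \<xi> p) r)" for r
        using A(2) by (simp add: represents_def l2_inner_mc)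
      show "fourier_U_inv \<mu> U f p = A p"
        unfolding fourier_U_inv_def
      proof (rule the_equality)
        fix z assume z: "\<forall>r. hinner z r = (LINT \<xi>|\<mu>. f \<xi> * hinner (U \<xi> p) r)"
        show "z = A p" by (rule hinner_eqI) (simp only: z *)
      qed (simp add: *)
    qed
    then show "hilbert_schmidt (fourier_U_inv \<mu> U f)"
      "AE \<xi> in \<mu>. V (fourier_U_inv \<mu> U f) \<xi> = f \<xi>"
      using A V_eq by auto
  qed
qed

end
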